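(* Let $N\ge 2$ be an integer, let $\mu$ be a probability measure on $\mathcal B_{[0,1]}$ with $\mu\ll\lambda$ ($\lambda$ being Lebesgue measure), and put $f_N^0(x)=(x+N-1)\,\frac{d\mu}{d\lambda}(x)$, $x\in[0,1]$. Assume that $f_N^0\in C^1([0,1])$ and $(f_N^0)'>0$ on $[0,1]$. Let $\varphi_N$, $v_N$, $w_N$ be the function and constants defined in the context, and put $$\alpha_N=\min_{x\in[0,1]}\frac{-\varphi_N(x)}{(f_N^0)'(x)},\qquad \beta_N=\max_{x\in[0,1]}\frac{-\varphi_N(x)}{(f_N^0)'(x)},\qquad G_N(x)=\frac{1}{\log\left(\frac{N}{N-1}\right)}\log\left(\frac{x+N-1}{N-1}\right).$$ Then for every integer $n\ge 1$ and every $x\in[0,1]$, $$\left(\log\left(\tfrac{N}{N-1}\right)\right)^2\cdot\frac N2\cdot\frac{\alpha_N}{\beta_N}\,\min_{y\in[0,1]}(f_N^0)'(y)\cdot v_N^n\,G_N(x)(1-G_N(x))\ \le\ \left|\mu(R_N^n<x)-G_N(x)\right|$$ and $$\left|\mu(R_N^n<x)-G_N(x)\right|\ \le\ \left(\log\left(\tfrac{N}{N-1}\right)\right)^2\cdot\frac N2\cdot\frac{\beta_N}{\alpha_N}\,\max_{y\in[0,1]}(f_N^0)'(y)\cdot w_N^n\,G_N(x)(1-G_N(x)).$$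
   Context: Let $N\ge2$ be an integer. The Rényi-type continued fraction transformation $R_N:[0,1]\to[0,1]$ is $R_N(x)=\frac{N}{1-x}-\left\lfloor\frac{N}{1-x}\right\rfloor$ for $x\in[0,1)$ and $R_N(1)=0$. $R_N^n$ is its $n$-th iterate, and $\mu(R_N^n<x)=\mu(\{y\in[0,1]:R_N^n(y)<x\})$. $\mathcal B_{[0,1]}$ is the Borel $\sigma$-algebra of $[0,1]$. $C([0,1])$ (resp. $C^1([0,1])$) denotes the continuous (resp. continuously differentiable) functions on $[0,1]$. For integers $i\ge N$ put $u_{N,i}(x)=1-\frac{N}{x+i}$. The operator $V:C([0,1])\to C([0,1])$ is $$Vg(x)=-\sum_{i\ge N}\left\{\frac{i+1-N}{(x+i)^2}\int_{u_{N,i}(x)}^{u_{N,i+1}(x)}g(u)\,du+\frac{N(x+N-1)}{(x+i-1)(x+i)^3}\,g(u_{N,i}(x))\right\}.$$ The function $\varphi_N$ and constants $v_N,w_N$ are defined as follows. For $e_N>0$ let $$H_N(t)=2(t+e_N+1)^4+e_N^3N^2(1-2N)(t+1)-e_N^4N^3 .$$ Fix $e_N>0$ such that $H_N(0)<0$, $H_N(1)>0$ and $H_N'(t)>0$ for $t\in[0,1]$, and let $t_N$ be the unique solution in $[0,1]$ of $H_N(t_N)=0$. Put $$\varphi_N(x)=\frac{-N(e_NN-t_N-1)}{\left\{e_NNx+(t_N+1)(1-x)\right\}^2}-\frac{N\left\{2e_N-(e_NN-t_N-1)\right\}}{\left\{e_N(Nx+1-x)+(t_N+1)(1-x)\right\}^2},\quad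 x\in[0,1],$$ $$v_N=\frac{e_N^2N}{2(e_N+t_N+1)^2},\qquad w_N=-\frac1{m_N},\qquad m_N=\max_{x\in[0,1]}\frac{\varphi_N(x)}{V\varphi_N(x)}.$$ *)

theory Defs
  imports "HOL-Probability.Probability"
begin

abbreviation unit_lborel :: "real measure" where
  "unit_lborel \<equiv> restrict_space lborel {0..1}"

definition renyi_map :: "nat \<Rightarrow> real \<Rightarrow> real" where
  "renyi_map N x =
     (if x = 1 then 0 else real N / (1 - x) - of_int \<lfloor>real N / (1 - x)\<rfloor>)"

definition inv_branch :: "nat \<Rightarrow> nat \<Rightarrow> real \<Rightarrow> real" where
  "inv_branch N i x = 1 - real N / (x + real i)"

text \<open>
  The operator is of interest for arguments \<open>g\<close> continuous on \<open>[0,1]\<close> and points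
  \<open>x \<in> [0,1]\<close>.  There the end points of the integrals lie in \<open>[0,1]\<close> in increasing order, and
  the terms are \<open>O(1 / i^3)\<close>, so the series converges absolutely and \<open>infsum\<close> is its sum.
\<close>

definition V_op :: "nat \<Rightarrow> (real \<Rightarrow> real) \<Rightarrow> real \<Rightarrow> real" where
  "V_op N g x =
     - (\<Sum>\<^sub>\<infinity>i\<in>{N..}.
          (real i + 1 - real N) / (x + real i)\<^sup>2
            * integral {inv_branch N i x..inv_branch N (i + 1) x} g
        + real N * (x + real N - 1) / ((x + real i - 1) * (x + real i) ^ 3)
            * g (inv_branch N i x))"

definition H_poly :: "nat \<Rightarrow> real \<Rightarrow> real \<Rightarrow> real" where
  "H_poly N e t = 2 * (t + e + 1) ^ 4 + e ^ 3 * (real N)\<^sup>2 * (1 - 2 * real N) * (t + 1)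
     - e ^ 4 * (real N) ^ 3"

definition phi :: "nat \<Rightarrow> real \<Rightarrow> real \<Rightarrow> real \<Rightarrow> real" where
  "phi N e t x =
     - real N * (e * real N - t - 1) / (e * real N * x + (t + 1) * (1 - x))\<^sup>2
     - real N * (2 * e - (e * real N - t - 1))
         / (e * (real N * x + 1 - x) + (t + 1) * (1 - x))\<^sup>2"

definition v_const :: "nat \<Rightarrow> real \<Rightarrow> real \<Rightarrow> real" where
  "v_const N e t = e\<^sup>2 * real N / (2 * (e + t + 1)\<^sup>2)"

text \<open>
  Minima and maxima over \<open>[0,1]\<close> are written as \<open>INF\<close> and \<open>SUP\<close>.  They are only used for
  functions that are continuous on \<open>[0,1]\<close>, where these bounds are attained.
\<close>

definition m_const :: "nat \<Rightarrow> real \<Rightarrow> real \<Rightarrow> real" where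
  "m_const N e t = (SUP x\<in>{0..1}. phi N e t x / V_op N (phi N e t) x)"

definition w_const :: "nat \<Rightarrow> real \<Rightarrow> real \<Rightarrow> real" where
  "w_const N e t = - 1 / m_const N e t"

text \<open>In the next two definitions \<open>f'\<close> stands for the derivative of the initial function.\<close>

definition alpha_const :: "nat \<Rightarrow> real \<Rightarrow> real \<Rightarrow> (real \<Rightarrow> real) \<Rightarrow> real" where
  "alpha_const N e t f' = (INF x\<in>{0..1}. - phi N e t x / f' x)"

definition beta_const :: "nat \<Rightarrow> real \<Rightarrow> real \<Rightarrow> (real \<Rightarrow> real) \<Rightarrow> real" where
  "beta_const N e t f' = (SUP x\<in>{0..1}. - phi N e t x / f' x)"

definition G_dist :: "nat \<Rightarrow> real \<Rightarrow> real" where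
  "G_dist N x = 1 / ln (real N / (real N - 1)) * ln ((x + real N - 1) / (real N - 1))"

end

theory Submission
  imports Defs
begin

text \<open>
  Write the density of a random point as \<open>f x / (x + N - 1)\<close>.  Applying the map once replaces
  \<open>f\<close> by \<open>U f\<close>, where \<open>U\<close> is a Markov operator, an average over the inverse branches
  (\<open>renyi_transfer_iter\<close>).  So the distribution function of the \<open>n\<close>-th iterate is the
  integral of \<open>(U ^ n f) x / (x + N - 1)\<close>, and the constant function corresponds to the limit
  distribution \<open>G\<close>.  The rate of convergence is the rate at which \<open>U ^ n f\<close> flattens.

  Flattening is measured by an order: \<open>P\<close> lies below \<open>f\<close> if \<open>f - P\<close> is increasing, which
  for differentiable functions means \<open>P' \<le> f'\<close>.  The operator preserves this order, because it
  maps increasing functions to increasing functions (\<open>renyi_op_mono_on\<close>).  Differentiating,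
  \<open>(U f)' = - V f'\<close>, so \<open>- V\<close> is the positive operator that acts on the derivatives; the
  order expresses the same positivity in terms of increments.

  The function \<open>- phi\<close> is positive and has a primitive \<open>P\<close> for which \<open>U P\<close> is a
  telescoping series with the sum \<open>- 1 / (e (x + b))\<close>, where \<open>b = (t + 1) / e\<close>
  (\<open>renyi_op_test_prim\<close>, and \<open>V_op_test_fun\<close> for the derivative).  Thus the quotient
  \<open>- phi / V phi\<close> is an explicit rational function.  The equation for \<open>t\<close> makes its values
  at the two end points equal, and this common value \<open>1 / v\<close> is its maximum
  (\<open>test_ratio_le\<close>), while its minimum is \<open>1 / w\<close> by definition.  In the above order
  therefore \<open>v P\<close> lies below \<open>U P\<close>, and \<open>U P\<close> below \<open>w P\<close>.  By the choice of
  \<open>\<alpha>\<close> and \<open>\<beta>\<close> as bounds of \<open>- phi / f'\<close>, also \<open>P / \<beta>\<close> lies below \<open>f\<close>, and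
  \<open>f\<close> below \<open>P / \<alpha>\<close>.  Iteration shows that \<open>U ^ n f\<close>
  lies between \<open>v ^ n P / \<beta>\<close> and \<open>w ^ n P / \<alpha>\<close>.

  Finally \<open>P\<close> is compared with multiples of \<open>ln (x + N - 1)\<close>, which are expressed by the
  extreme values of \<open>f'\<close>; for the bound from below this rests on \<open>test_fun_lower\<close>.  If a
  multiple of \<open>ln (x + N - 1)\<close> lies below or above \<open>U ^ n f\<close>, then Chebyshev's inequality
  gives the corresponding multiple of \<open>G (1 - G)\<close> as a lower or upper bound for the distance
  of the distribution functions (\<open>distribution_gap\<close>).
\<close>

section \<open>Monotone and continuous functions on the unit interval\<close>

lemma mono_on_unit_bounded:
  fixes f :: "real \<Rightarrow> real"
  assumes "mono_on {0..1} f" "y \<in> {0..1}"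
  shows "\<bar>f y\<bar> \<le> \<bar>f 0\<bar> + \<bar>f 1\<bar>"
  using mono_onD[OF assms(1), of 0 y] mono_onD[OF assms(1), of y 1] assms(2) by auto

lemma mono_on_unit_if_deriv_nonneg:
  fixes g g' :: "real \<Rightarrow> real"
  assumes "\<And>x. x \<in> {0..1} \<Longrightarrow> (g has_real_derivative g' x) (at x within {0..1})"
    and "\<And>x. x \<in> {0..1} \<Longrightarrow> g' x \<ge> 0"
  shows "mono_on {0..1} g"
proof (rule mono_onI)
  fix x y :: real assume xy: "x \<in> {0..1}" "y \<in> {0..1}" "x \<le> y"
  have sub: "{x..y} \<subseteq> {0..1}" using xy by auto
  have "(g' has_integral g y - g x) {x..y}"
    using sub by (intro fundamental_theorem_of_calculus[OF xy(3)])
      (auto simp flip: has_real_derivative_iff_has_vector_derivative intro!: has_field_derivative_subset[OF assms(1)])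
  then have "g y - g x \<ge> 0" by (rule has_integral_nonneg) (use sub assms(2) in auto)
  then show "g x \<le> g y" by simp
qed

lemma mono_on_unit_add:
  fixes f g :: "real \<Rightarrow> real"
  assumes "mono_on {0..1} f" "mono_on {0..1} g" "\<And>u. u \<in> {0..1} \<Longrightarrow> h u = f u + g u"
  shows "mono_on {0..1} h"
proof (rule mono_onI)
  fix x y :: real assume "x \<in> {0..1}" "y \<in> {0..1}" "x \<le> y"
  then show "h x \<le> h y" using mono_onD[OF assms(1), of x y] mono_onD[OF assms(2), of x y] assms(3) by auto
qed

lemma mono_on_unit_scale:
  fixes f :: "real \<Rightarrow> real"
  assumes "mono_on {0..1} f" "a \<ge> 0" shows "mono_on {0..1} (\<lambda>u. a * f u)"
  using assms by (auto simp: mono_on_def mult_left_mono)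

lemma borel_measurable_mono_on_unit:
  fixes f :: "real \<Rightarrow> real"
  assumes "mono_on {0..1} f"
  shows "(\<lambda>y. indicator {0..1} y * f y) \<in> borel_measurable borel"
  using borel_measurable_mono_on_fnc[OF assms] by (simp add: borel_measurable_restrict_space_iff)

lemma continuous_on_unit_bounds:
  fixes g :: "real \<Rightarrow> real"
  assumes "continuous_on {0..1} g"
  shows "y \<in> {0..1} \<Longrightarrow> (INF u\<in>{0..1}. g u) \<le> g y" "y \<in> {0..1} \<Longrightarrow> g y \<le> (SUP u\<in>{0..1}. g u)"
    and "(\<And>u. u \<in> {0..1} \<Longrightarrow> g u > 0) \<Longrightarrow> (INF u\<in>{0..1}. g u) > 0"
proof -
  have c: "compact (g ` {0..1})" by (rule compact_continuous_image[OF assms]) simp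
  then have b: "bdd_below (g ` {0..1})" "bdd_above (g ` {0..1})"
    using bounded_imp_bdd_below[OF compact_imp_bounded[OF c]] bounded_imp_bdd_above[OF compact_imp_bounded[OF c]]
    by simp_all
  show "y \<in> {0..1} \<Longrightarrow> (INF u\<in>{0..1}. g u) \<le> g y" by (rule cINF_lower[OF b(1)])
  show "y \<in> {0..1} \<Longrightarrow> g y \<le> (SUP u\<in>{0..1}. g u)" by (rule cSUP_upper[OF _ b(2)])
  assume pos: "\<And>u. u \<in> {0..1} \<Longrightarrow> g u > 0"
  obtain z where z: "z \<in> {0..1}" "\<And>u. u \<in> {0..1} \<Longrightarrow> g z \<le> g u"
    using continuous_attains_inf[OF compact_Icc _ assms] by auto
  have "g z \<le> (INF u\<in>{0..1}. g u)" using z by (intro cINF_greatest) auto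
  with pos[OF z(1)] show "(INF u\<in>{0..1}. g u) > 0" by simp
qed

lemma nonneg_of_AE_nonneg:
  fixes f :: "real \<Rightarrow> real"
  assumes f: "mono_on {0..1} f" "continuous_on {0..1} f" and AE: "AE y in unit_lborel. f y \<ge> 0" and y: "y \<in> {0..1}"
  shows "f y \<ge> 0"
proof (rule ccontr)
  assume "\<not> f y \<ge> 0"
  then have "f 0 < 0" using mono_onD[OF f(1), of 0 y] y by auto
  then obtain d where d: "d > 0" "\<And>u. u \<in> {0..1} \<Longrightarrow> dist u 0 < d \<Longrightarrow> dist (f u) (f 0) < - f 0"
    using f(2)[unfolded continuous_on_iff, rule_format, of 0 "- f 0"] by auto
  have "AE u in lborel. u \<in> {0..1} \<longrightarrow> 0 \<le> f u"
    using AE by (simp add: AE_restrict_space_iff)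
  then have "AE u in lborel. u \<notin> {0<..<min d 1}"
  proof eventually_elim
    case (elim u)
    then show ?case using d(2)[of u] by (auto simp: dist_real_def)
  qed
  then have "emeasure lborel {0<..<min d 1} = 0"
    by (subst (asm) AE_iff_null_sets[symmetric]) auto
  then show False using d(1) by simp
qed

section \<open>The transfer operator and monotonicity\<close>

definition branch_prob :: "nat \<Rightarrow> nat \<Rightarrow> real \<Rightarrow> real" where
  "branch_prob N k x = (x + real N - 1) / ((x + real N + real k) * (x + real N + real k - 1))"

text \<open>
  The Perron-Frobenius operator of the map with respect to its invariant measure, whose density is
  proportional to \<open>1 / (x + N - 1)\<close>.  If \<open>f x / (x + N - 1)\<close> is the density of a
  random point, then \<open>renyi_op N f x / (x + N - 1)\<close> is the density of its image.
\<close>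

definition renyi_op :: "nat \<Rightarrow> (real \<Rightarrow> real) \<Rightarrow> real \<Rightarrow> real" where
  "renyi_op N f x = (\<Sum>k. branch_prob N k x * f (inv_branch N (N + k) x))"

lemma inv_branch_alt: "inv_branch N (N + k) x = 1 - real N / (x + real N + real k)"
  by (simp add: inv_branch_def add.assoc)

lemma branch_prob_nonneg: "N \<ge> 2 \<Longrightarrow> x \<ge> 0 \<Longrightarrow> branch_prob N k x \<ge> 0"
  by (auto simp: branch_prob_def intro!: divide_nonneg_nonneg mult_nonneg_nonneg)

lemma inv_branch_in_unit:
  assumes "N \<ge> 2" "x \<in> {0..1}" shows "inv_branch N (N + k) x \<in> {0..1}"
  using assms by (auto simp: inv_branch_alt field_simps)

lemma inv_branch_mono:
  assumes "N \<ge> 2" "0 \<le> x" "x \<le> y" shows "inv_branch N (N + k) x \<le> inv_branch N (N + k) y"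
  using assms by (auto simp: inv_branch_alt intro!: divide_left_mono mult_pos_pos)

lemma inv_branch_Suc_ge:
  assumes "N \<ge> 2" "0 \<le> x" shows "inv_branch N (N + k) x \<le> inv_branch N (N + Suc k) x"
  unfolding inv_branch_alt using assms by (auto intro!: divide_left_mono mult_pos_pos)

text \<open>
  The terms telescope, since \<open>branch_prob N k x\<close> equals
  \<open>(k + 1) / (x + N + k) - k / (x + N + k - 1)\<close>.  The closed form shows that the partial sums
  decrease in \<open>x\<close>: a larger \<open>x\<close> moves probability towards the branches of larger
  index, which is the stochastic monotonicity behind the operator.
\<close>

lemma sum_branch_prob:
  assumes "N \<ge> 2" "x \<ge> 0"
  shows "(\<Sum>k<n. branch_prob N k x) = real n / (x + real N + real n - 1)"
proof (induction n)
  case (Suc n)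
  have "real n / (x + real N + real n - 1) + branch_prob N n x = real (Suc n) / (x + real N + real (Suc n) - 1)"
  proof -
    define z where "z = x + real N + real n"
    have z: "z - 1 > 0" "z > 0" using assms by (auto simp: z_def)
    have "real n / (z - 1) + (z - real n - 1) / (z * (z - 1)) = (real n + 1) / z"
      using z by (simp add: divide_simps) (simp add: algebra_simps)
    then show ?thesis by (simp add: branch_prob_def z_def algebra_simps)
  qed
  with Suc show ?case by simp
qed simp

lemma branch_prob_sums:
  assumes "N \<ge> 2" "x \<ge> 0" shows "(\<lambda>k. branch_prob N k x) sums 1"
  unfolding sums_def sum_branch_prob[OF assms] by real_asymp

lemma summable_renyi_op:
  assumes "N \<ge> 2" "x \<in> {0..1}" "\<And>y. y \<in> {0..1} \<Longrightarrow> \<bar>f y\<bar> \<le> C"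
  shows "summable (\<lambda>k. branch_prob N k x * f (inv_branch N (N + k) x))"
proof (rule summable_comparison_test')
  show "summable (\<lambda>k. branch_prob N k x * C)"
    using branch_prob_sums[of N x] assms by (intro summable_mult2) (auto simp: sums_iff)
  show "norm (branch_prob N k x * f (inv_branch N (N + k) x)) \<le> branch_prob N k x * C" for k
    using branch_prob_nonneg[of N x k] assms inv_branch_in_unit[OF assms(1,2)]
    by (auto simp: abs_mult intro!: mult_left_mono)
qed

text \<open>
  Summation by parts: moving mass to the right does not decrease the mean of an increasing sequence.
  The boundary term on the left-hand side vanishes in the limit when \<open>a\<close> is bounded and
  the masses add up to zero.
\<close>

lemma sum_mono_stochastic:
  fixes q a :: "nat \<Rightarrow> real"
  assumes "\<And>n. sum q {..<n} \<le> 0" "incseq a"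
  shows "sum q {..<n} * a n \<le> (\<Sum>k<n. q k * a k)"
proof (induction n)
  case (Suc n)
  have "sum q {..<Suc n} * a (Suc n) \<le> sum q {..<Suc n} * a n"
    using assms(1)[of "Suc n"] incseq_SucD[OF assms(2), of n] by (intro mult_left_mono_neg)
  with Suc show ?case by (simp add: algebra_simps)
qed simp

text \<open>
  There are two effects when \<open>x\<close> increases.  Every point \<open>inv_branch N (N + k) x\<close> moves
  to the right, and the weights move to branches of larger index, whose points lie further to the
  right.  Both increase the mean of an increasing function.  For differentiable functions this is the formula
  \<open>(U f)' = - V f'\<close> with \<open>- V\<close> positive.
\<close>

lemma renyi_op_mono_on:
  assumes N: "N \<ge> 2" and f: "mono_on {0..1} f"
  shows "mono_on {0..1} (renyi_op N f)"
proof (rule mono_onI)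
  fix x y :: real assume xy: "x \<in> {0..1}" "y \<in> {0..1}" "x \<le> y"
  let ?u = "\<lambda>x k. inv_branch N (N + k) x" and ?p = "\<lambda>x k. branch_prob N k x"
  have su: "summable (\<lambda>k. ?p z k * f (?u z k))" if "z \<in> {0..1}" for z
    using summable_renyi_op[OF N that mono_on_unit_bounded[OF f]] .
  define a where "a = (\<lambda>k. f (?u x k))"
  have ui: "?u x k \<in> {0..1}" "?u y k \<in> {0..1}" for k
    using inv_branch_in_unit[OF N] xy by blast+
  have inc: "incseq a" unfolding a_def
    using ui xy(1) inv_branch_Suc_ge[OF N] by (intro incseq_SucI mono_onD[OF f]) (blast | force)+
  have ab: "\<bar>a k\<bar> \<le> \<bar>f 0\<bar> + \<bar>f 1\<bar>" for k
    unfolding a_def using mono_on_unit_bounded[OF f] ui by blast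
  have say: "summable (\<lambda>k. ?p y k * a k)"
  proof (rule summable_comparison_test')
    show "summable (\<lambda>k. ?p y k * (\<bar>f 0\<bar> + \<bar>f 1\<bar>))"
      using branch_prob_sums[of N y] N xy by (intro summable_mult2) (auto simp: sums_iff)
    show "norm (?p y k * a k) \<le> ?p y k * (\<bar>f 0\<bar> + \<bar>f 1\<bar>)" for k
      using branch_prob_nonneg[of N y k] N xy ab[of k] by (auto simp: abs_mult intro!: mult_left_mono)
  qed
  define q where "q = (\<lambda>k. ?p y k - ?p x k)"
  have sq: "sum q {..<n} = real n / (y + real N + real n - 1) - real n / (x + real N + real n - 1)" for n
    using N xy by (simp add: q_def sum_subtractf sum_branch_prob)
  have "sum q {..<n} \<le> 0" for n unfolding sq using N xy by (auto intro!: divide_left_mono mult_pos_pos)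
  then have ge: "sum q {..<n} * a n \<le> (\<Sum>k<n. q k * a k)" for n
    using inc by (rule sum_mono_stochastic)
  have "(\<lambda>n. sum q {..<n}) \<longlonglongrightarrow> 0" unfolding sq by real_asymp
  then have lim0: "(\<lambda>n. sum q {..<n} * a n) \<longlonglongrightarrow> 0"
    using ab by (intro lim_null_mult_right_bounded[where B = "\<bar>f 0\<bar> + \<bar>f 1\<bar>"]) auto
  have lim1: "(\<lambda>n. \<Sum>k<n. q k * a k) \<longlonglongrightarrow> (\<Sum>k. ?p y k * a k) - renyi_op N f x"
    unfolding renyi_op_def using sums_diff[OF summable_sums[OF say] summable_sums[OF su[OF xy(1)]]]
    by (simp add: sums_def q_def a_def algebra_simps)
  have "renyi_op N f x \<le> (\<Sum>k. ?p y k * a k)"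
    using LIMSEQ_le[OF lim0 lim1] ge by auto
  also have "\<dots> \<le> renyi_op N f y" unfolding renyi_op_def a_def
    using xy ui N by (intro suminf_le mult_left_mono mono_onD[OF f] branch_prob_nonneg inv_branch_mono su say[unfolded a_def]) auto
  finally show "renyi_op N f x \<le> renyi_op N f y" .
qed

lemma renyi_op_diff:
  assumes "N \<ge> 2" "x \<in> {0..1}" "mono_on {0..1} f" "mono_on {0..1} g"
  shows "renyi_op N (\<lambda>y. a * f y - c * g y) x = a * renyi_op N f x - c * renyi_op N g x"
proof -
  note s = summable_sums[OF summable_renyi_op[OF assms(1,2) mono_on_unit_bounded]]
  have "(\<lambda>k. a * (branch_prob N k x * f (inv_branch N (N + k) x)) - c * (branch_prob N k x * g (inv_branch N (N + k) x)))
     sums (a * renyi_op N f x - c * renyi_op N g x)"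
    unfolding renyi_op_def
    by (intro sums_diff sums_mult s[OF assms(3)] s[OF assms(4)])
  then show ?thesis unfolding renyi_op_def by (simp add: sums_iff algebra_simps)
qed

lemma renyi_op_nonneg:
  assumes "N \<ge> 2" "mono_on {0..1} f" "\<And>y. y \<in> {0..1} \<Longrightarrow> f y \<ge> 0" "x \<in> {0..1}"
  shows "renyi_op N f x \<ge> 0"
  unfolding renyi_op_def using assms inv_branch_in_unit[OF assms(1,4)]
  by (intro suminf_nonneg summable_renyi_op[OF assms(1,4) mono_on_unit_bounded[OF assms(2)]]) (auto intro!: mult_nonneg_nonneg branch_prob_nonneg)

lemma renyi_op_iter_mono_on:
  assumes "N \<ge> 2" "mono_on {0..1} f" shows "mono_on {0..1} ((renyi_op N ^^ n) f)"
proof (induction n)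
  case (Suc n)
  then show ?case using renyi_op_mono_on[OF assms(1)] by simp
qed (simp add: assms(2))

lemma renyi_op_iter_nonneg:
  assumes "N \<ge> 2" "mono_on {0..1} f" "\<And>y. y \<in> {0..1} \<Longrightarrow> f y \<ge> 0" "x \<in> {0..1}"
  shows "(renyi_op N ^^ n) f x \<ge> 0"
  using assms(4)
proof (induction n arbitrary: x)
  case 0
  then show ?case using assms(3) by simp
next
  case (Suc n)
  show ?case using renyi_op_nonneg[OF assms(1) renyi_op_iter_mono_on[OF assms(1,2)] Suc.IH Suc.prems] by simp
qed

text \<open>
  The order relation in which \<open>P\<close> lies below \<open>f\<close> if \<open>f - P\<close> is increasing is
  preserved by the operator.  Hence a one-step comparison of \<open>renyi_op N P\<close> with \<open>P\<close>
  can be iterated, and each step contributes one factor \<open>v\<close> (or \<open>w\<close> in the next lemma).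
\<close>

lemma renyi_op_iter_lower:
  assumes N: "N \<ge> 2" and P: "mono_on {0..1} P" and v: "mono_on {0..1} (\<lambda>u. renyi_op N P u - v * P u)" "v \<ge> 0"
    and f: "mono_on {0..1} f" "mono_on {0..1} (\<lambda>u. f u - c * P u)" "c \<ge> 0"
  shows "mono_on {0..1} (\<lambda>u. (renyi_op N ^^ n) f u - c * v ^ n * P u)"
proof (induction n)
  case (Suc n)
  let ?h = "(renyi_op N ^^ n) f"
  have "mono_on {0..1} (renyi_op N (\<lambda>u. 1 * ?h u - c * v ^ n * P u))"
    using Suc by (intro renyi_op_mono_on[OF N]) simp
  moreover have "mono_on {0..1} (\<lambda>u. c * v ^ n * (renyi_op N P u - v * P u))"
    using v f(3) by (intro mono_on_unit_scale) auto
  ultimately show ?case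
  proof (rule mono_on_unit_add)
    fix u :: real assume u: "u \<in> {0..1}"
    show "(renyi_op N ^^ Suc n) f u - c * v ^ Suc n * P u =
        renyi_op N (\<lambda>u. 1 * ?h u - c * v ^ n * P u) u + c * v ^ n * (renyi_op N P u - v * P u)"
      unfolding renyi_op_diff[OF N u renyi_op_iter_mono_on[OF N f(1)] P] by (simp add: algebra_simps)
  qed
qed (simp add: f(2))

lemma renyi_op_iter_upper:
  assumes N: "N \<ge> 2" and P: "mono_on {0..1} P" and w: "mono_on {0..1} (\<lambda>u. w * P u - renyi_op N P u)" "w \<ge> 0"
    and f: "mono_on {0..1} f" "mono_on {0..1} (\<lambda>u. c * P u - f u)" "c \<ge> 0"
  shows "mono_on {0..1} (\<lambda>u. c * w ^ n * P u - (renyi_op N ^^ n) f u)"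
proof (induction n)
  case (Suc n)
  let ?h = "(renyi_op N ^^ n) f"
  have "mono_on {0..1} (renyi_op N (\<lambda>u. c * w ^ n * P u - 1 * ?h u))"
    using Suc by (intro renyi_op_mono_on[OF N]) simp
  moreover have "mono_on {0..1} (\<lambda>u. c * w ^ n * (w * P u - renyi_op N P u))"
    using w f(3) by (intro mono_on_unit_scale) auto
  ultimately show ?case
  proof (rule mono_on_unit_add)
    fix u :: real assume u: "u \<in> {0..1}"
    show "c * w ^ Suc n * P u - (renyi_op N ^^ Suc n) f u =
        renyi_op N (\<lambda>u. c * w ^ n * P u - 1 * ?h u) u + c * w ^ n * (w * P u - renyi_op N P u)"
      unfolding renyi_op_diff[OF N u P renyi_op_iter_mono_on[OF N f(1)]] by (simp add: algebra_simps)
  qed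
qed (simp add: f(2))

section \<open>Densities along the orbit of the map\<close>

lemma inv_branch_deriv:
  assumes "x + real N + real k \<noteq> 0"
  shows "(inv_branch N (N + k) has_real_derivative real N / (x + real N + real k)\<^sup>2) (at x within S)"
proof -
  have "inv_branch N (N + k) = (\<lambda>x. 1 - real N / (x + real N + real k))" by (simp add: fun_eq_iff inv_branch_alt)
  then show ?thesis using assms by (auto intro!: derivative_eq_intros simp: power2_eq_square)
qed

lemma renyi_map_measurable[measurable]: "renyi_map N \<in> borel_measurable borel"
  unfolding renyi_map_def by measurable

lemma renyi_inv_branch:
  assumes "N \<ge> 2" "s \<in> {0..<1}"
  shows "renyi_map N (inv_branch N (N + k) s) = s"
proof -
  have p: "s + real N + real k > 0" using assms by auto
  then have "inv_branch N (N + k) s \<noteq> 1" using assms by (auto simp: inv_branch_alt)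
  moreover have "real N / (1 - inv_branch N (N + k) s) = s + of_int (int (N + k))"
    using p assms by (simp add: inv_branch_alt)
  moreover have "\<lfloor>s + of_int (int (N + k))\<rfloor> = int (N + k)"
    using assms by (intro floor_unique) auto
  ultimately show ?thesis by (simp add: renyi_map_def)
qed

text \<open>
  The left end points of the intervals on which the map is continuous.
\<close>

definition cut :: "nat \<Rightarrow> nat \<Rightarrow> real" where "cut N k = inv_branch N (N + k) 0"

lemma cut_Suc: "inv_branch N (N + k) 1 = cut N (Suc k)"
  by (simp add: cut_def inv_branch_def algebra_simps)

lemma incseq_cut: "N \<ge> 2 \<Longrightarrow> incseq (cut N)"
  unfolding cut_def by (intro incseq_SucI inv_branch_Suc_ge) auto

lemma cut_bounds: "N \<ge> 2 \<Longrightarrow> 0 \<le> cut N k \<and> cut N k < 1"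
  by (auto simp: cut_def inv_branch_def field_simps)

lemma disjoint_family_cut:
  assumes "N \<ge> 2" shows "disjoint_family (\<lambda>k. {cut N k..<cut N (Suc k)})"
proof -
  have "{cut N m..<cut N (Suc m)} \<inter> {cut N n..<cut N (Suc n)} = {}" if "m < n" for m n
  proof -
    have "cut N (Suc m) \<le> cut N n" using incseqD[OF incseq_cut[OF assms], of "Suc m" n] that by simp
    then show ?thesis by auto
  qed
  then show ?thesis unfolding disjoint_family_on_def by (metis Int_commute linorder_neqE_nat)
qed

text \<open>
  The branch of \<open>y\<close> is given by the integer part of \<open>N / (1 - y)\<close>.
\<close>

lemma ex_cut:
  assumes "N \<ge> 2" "y \<in> {0..<1}"
  shows "\<exists>k. y \<in> {cut N k..<cut N (Suc k)}"
proof -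
  define z where "z = real N / (1 - y)"
  have z: "z \<ge> real N" using assms by (auto simp: z_def field_simps)
  define i where "i = nat \<lfloor>z\<rfloor>"
  have i: "real i \<le> z" "z < real i + 1" using z by (auto simp: i_def)
  have "N \<le> i" using z by (auto simp: i_def le_nat_floor)
  then obtain k where k: "i = N + k" using le_Suc_ex by blast
  have y: "y = 1 - real N / z" using assms by (auto simp: z_def)
  have "1 - real N / real i \<le> y" unfolding y using i z assms k by (auto intro!: divide_left_mono mult_pos_pos)
  moreover have "y < 1 - real N / (real i + 1)" unfolding y using i z assms k
    by (auto intro!: divide_strict_left_mono mult_pos_pos)
  ultimately have "y \<in> {cut N k..<cut N (Suc k)}" by (simp add: cut_def inv_branch_def k algebra_simps)
  then show ?thesis ..
qed

text \<open>
  Substitution of \<open>y = inv_branch N (N + k) s\<close> on a single branch.  There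
  \<open>y + N - 1 = N (s + N + k - 1) / (s + N + k)\<close>, and this together with the derivative of the
  inverse branch turns the weight \<open>1 / (y + N - 1)\<close> into
  \<open>branch_prob N k s / (s + N - 1)\<close>.
\<close>

lemma nn_integral_branch:
  assumes N: "N \<ge> 2" and f: "mono_on {0..1} f" and g[measurable]: "g \<in> borel_measurable borel"
  shows "(\<integral>\<^sup>+ y. ennreal (f y / (y + real N - 1)) * g (renyi_map N y) * indicator {cut N k..<cut N (Suc k)} y \<partial>lborel) =
    (\<integral>\<^sup>+ s. ennreal (branch_prob N k s * f (inv_branch N (N + k) s) / (s + real N - 1)) * g s * indicator {0..1} s \<partial>lborel)"
proof -
  let ?u = "inv_branch N (N + k)"
  note [measurable] = borel_measurable_mono_on_unit[OF f]
  define F where "F = (\<lambda>y. ennreal (indicator {0..1} y * f y / (y + real N - 1)) * g (renyi_map N y))"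
  have F[measurable]: "F \<in> borel_measurable borel" unfolding F_def by measurable
  have sub: "{cut N k..cut N (Suc k)} \<subseteq> {0..1}" using cut_bounds[OF N, of k] cut_bounds[OF N, of "Suc k"] by auto
  have "(\<integral>\<^sup>+ y. ennreal (f y / (y + real N - 1)) * g (renyi_map N y) * indicator {cut N k..<cut N (Suc k)} y \<partial>lborel)
     = (\<integral>\<^sup>+ y. F y * indicator {?u 0..?u 1} y \<partial>lborel)"
    \<comment> \<open>the half-open interval of the partition and the closed one of the substitution rule differ by a null set\<close>
  proof (rule nn_integral_cong_AE, use AE_lborel_singleton[of "cut N (Suc k)"] in eventually_elim)
    case (elim y)
    then show ?case using sub unfolding cut_Suc F_def
      by (auto simp: cut_def[of N k, symmetric] split: split_indicator)
  qed
  also have "\<dots> = (\<integral>\<^sup>+ s. F (?u s) * ennreal (real N / (s + real N + real k)\<^sup>2) * indicator {0..1} s \<partial>lborel)"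
  proof (rule nn_integral_substitution_aux[OF F])
    show "(?u has_real_derivative real N / (s + real N + real k)\<^sup>2) (at s)" if "s \<in> {0..1}" for s
      by (rule inv_branch_deriv) (use N that in auto)
    show "continuous_on {0..1} (\<lambda>s. real N / (s + real N + real k)\<^sup>2)"
      by (intro continuous_intros) (use N in auto)
  qed auto
  also have "\<dots> = (\<integral>\<^sup>+ s. ennreal (branch_prob N k s * f (?u s) / (s + real N - 1)) * g s * indicator {0..1} s \<partial>lborel)"
    \<comment> \<open>at \<open>s = 1\<close> the inverse branch leads to the next interval of the partition, where the map takes the value \<open>0\<close>\<close>
  proof (rule nn_integral_cong_AE, use AE_lborel_singleton[of 1] in eventually_elim)
    case (elim s)
    show ?case
    proof (cases "s \<in> {0..1}")
      case True
      then have s: "s \<in> {0..<1}" using elim by auto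
      define y where "y = s + real N + real k"
      have y: "y > 1" "s + real N - 1 > 0" using N s by (auto simp: y_def)
      have u: "?u s + real N - 1 = real N * (y - 1) / y" using y by (simp add: inv_branch_alt y_def field_simps)
      have "f (?u s) / (?u s + real N - 1) * (real N / y\<^sup>2) = branch_prob N k s * f (?u s) / (s + real N - 1)"
      proof -
        have "v / (real N * (y - 1) / y) * (real N / y\<^sup>2) = v / (y * (y - 1))" for v
          using y N by (simp add: divide_simps power2_eq_square)
        moreover have "m / (y * (y - 1)) * v / m = v / (y * (y - 1))" if "m > 0" for m v :: real
          using that by simp
        ultimately show ?thesis unfolding u branch_prob_def y_def[symmetric] using y(2) by metis
      qed
      moreover have "ennreal (f (?u s) / (?u s + real N - 1)) * ennreal (real N / y\<^sup>2) = ennreal (f (?u s) / (?u s + real N - 1) * (real N / y\<^sup>2))"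
        by (rule ennreal_mult''[symmetric]) simp
      moreover have "?u s \<in> {0..1}" using inv_branch_in_unit[OF N True] .
      ultimately have A: "ennreal (f (?u s) / (?u s + real N - 1)) * ennreal (real N / y\<^sup>2) = ennreal (branch_prob N k s * f (?u s) / (s + real N - 1))"
        and Fu: "F (?u s) = ennreal (f (?u s) / (?u s + real N - 1)) * g s"
        using renyi_inv_branch[OF N s, of k] by (simp_all add: F_def)
      have "F (?u s) * ennreal (real N / y\<^sup>2) = ennreal (f (?u s) / (?u s + real N - 1)) * ennreal (real N / y\<^sup>2) * g s"
        unfolding Fu by (simp only: ac_simps)
      then have "F (?u s) * ennreal (real N / y\<^sup>2) = ennreal (branch_prob N k s * f (?u s) / (s + real N - 1)) * g s"
        unfolding A .
      then show ?thesis by (simp add: y_def)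
    qed simp
  qed
  finally show ?thesis .
qed

text \<open>
  The branches partition \<open>[0,1)\<close>, and all of them are mapped onto the same interval, so the
  contributions of the single branches add up to the series in the definition of the operator.
  Stating this for an arbitrary \<open>g\<close>, and not only for indicators of intervals, is what makes
  the iteration in the next lemma immediate.
\<close>

lemma renyi_transfer:
  assumes N: "N \<ge> 2" and f: "mono_on {0..1} f" and f0: "\<And>y. y \<in> {0..1} \<Longrightarrow> f y \<ge> 0"
    and g[measurable]: "g \<in> borel_measurable borel"
  shows "(\<integral>\<^sup>+ y. ennreal (f y / (y + real N - 1)) * g (renyi_map N y) * indicator {0..1} y \<partial>lborel) =
    (\<integral>\<^sup>+ s. ennreal (renyi_op N f s / (s + real N - 1)) * g s * indicator {0..1} s \<partial>lborel)"
proof -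
  let ?I = "\<lambda>k. {cut N k..<cut N (Suc k)}"
  note [measurable] = borel_measurable_mono_on_unit[OF f]
  define F where "F = (\<lambda>y. ennreal (indicator {0..1} y * f y / (y + real N - 1)) * g (renyi_map N y))"
  have F[measurable]: "F \<in> borel_measurable borel" unfolding F_def by measurable
  have sub: "?I k \<subseteq> {0..1}" for k using cut_bounds[OF N, of k] cut_bounds[OF N, of "Suc k"] by auto
  define T where "T = (\<lambda>k s. ennreal (branch_prob N k s * f (inv_branch N (N + k) s) / (s + real N - 1)) * g s * indicator {0..1} s)"
  have T_eq: "T k s = ennreal (branch_prob N k s * (indicator {0..1} (inv_branch N (N + k) s) * f (inv_branch N (N + k) s)) / (s + real N - 1)) * g s * indicator {0..1} s" for k s
    using inv_branch_in_unit[OF N, of s k] unfolding T_def by (auto split: split_indicator)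
  have T: "T k \<in> borel_measurable lborel" for k
  proof -
    have [measurable]: "inv_branch N (N + k) \<in> borel_measurable borel" "branch_prob N k \<in> borel_measurable borel"
      unfolding inv_branch_def[abs_def] branch_prob_def[abs_def] by measurable
    show ?thesis unfolding T_eq[abs_def] by measurable
  qed
  have "(\<integral>\<^sup>+ y. ennreal (f y / (y + real N - 1)) * g (renyi_map N y) * indicator {0..1} y \<partial>lborel) =
     (\<integral>\<^sup>+ y. (\<Sum>k. F y * indicator (?I k) y) \<partial>lborel)"
  proof (rule nn_integral_cong_AE, use AE_lborel_singleton[of 1] in eventually_elim)
    case (elim y)
    show ?case
    proof (cases "y \<in> {0..1}")
      case True
      then obtain k where "y \<in> ?I k" using ex_cut[OF N, of y] elim by auto
      then have "(\<Sum>k. F y * indicator (?I k) y) = F y"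
        by (rule suminf_cmult_indicator[OF disjoint_family_cut[OF N], where f = "\<lambda>_. F y"])
      then show ?thesis using True by (simp add: F_def)
    next
      case False
      then have "y \<notin> ?I k" for k using sub[of k] by blast
      then show ?thesis using False by simp
    qed
  qed
  also have "\<dots> = (\<Sum>k. \<integral>\<^sup>+ y. F y * indicator (?I k) y \<partial>lborel)"
    by (rule nn_integral_suminf) simp
  also have "\<dots> = (\<Sum>k. \<integral>\<^sup>+ s. T k s \<partial>lborel)"
  proof (intro arg_cong[where f = suminf] ext)
    fix k
    have "(\<integral>\<^sup>+ y. F y * indicator (?I k) y \<partial>lborel) = (\<integral>\<^sup>+ y. ennreal (f y / (y + real N - 1)) * g (renyi_map N y) * indicator (?I k) y \<partial>lborel)"
      using sub[of k] by (intro nn_integral_cong) (auto simp: F_def split: split_indicator)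
    then show "(\<integral>\<^sup>+ y. F y * indicator (?I k) y \<partial>lborel) = (\<integral>\<^sup>+ s. T k s \<partial>lborel)"
      unfolding T_def nn_integral_branch[OF N f g] by simp
  qed
  also have "\<dots> = (\<integral>\<^sup>+ s. (\<Sum>k. T k s) \<partial>lborel)"
    by (rule nn_integral_suminf[symmetric]) (rule T)
  also have "\<dots> = (\<integral>\<^sup>+ s. ennreal (renyi_op N f s / (s + real N - 1)) * g s * indicator {0..1} s \<partial>lborel)"
  proof (rule nn_integral_cong)
    fix s :: real
    show "(\<Sum>k. T k s) = ennreal (renyi_op N f s / (s + real N - 1)) * g s * indicator {0..1} s"
    proof (cases "s \<in> {0..1}")
      case True
      have "(\<lambda>k. branch_prob N k s * f (inv_branch N (N + k) s) / (s + real N - 1)) sums (renyi_op N f s / (s + real N - 1))"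
        unfolding renyi_op_def
        by (intro sums_divide summable_sums summable_renyi_op[OF N True mono_on_unit_bounded[OF f]])
      moreover have "branch_prob N k s * f (inv_branch N (N + k) s) / (s + real N - 1) \<ge> 0" for k
        using branch_prob_nonneg[OF N, of s k] f0[OF inv_branch_in_unit[OF N True]] True N by auto
      ultimately have "(\<Sum>k. ennreal (branch_prob N k s * f (inv_branch N (N + k) s) / (s + real N - 1))) = ennreal (renyi_op N f s / (s + real N - 1))"
        by (intro suminf_ennreal_eq)
      then show ?thesis unfolding T_def by simp
    qed (simp add: T_def)
  qed
  finally show ?thesis .
qed

lemma renyi_transfer_iter:
  assumes N: "N \<ge> 2" and f: "mono_on {0..1} f" "\<And>y. y \<in> {0..1} \<Longrightarrow> f y \<ge> 0"
    and g: "g \<in> borel_measurable borel"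
  shows "(\<integral>\<^sup>+ y. ennreal (f y / (y + real N - 1)) * g ((renyi_map N ^^ n) y) * indicator {0..1} y \<partial>lborel) =
    (\<integral>\<^sup>+ s. ennreal ((renyi_op N ^^ n) f s / (s + real N - 1)) * g s * indicator {0..1} s \<partial>lborel)"
  using g
proof (induction n arbitrary: g)
  case (Suc n)
  note [measurable] = Suc.prems
  have "(\<integral>\<^sup>+ y. ennreal (f y / (y + real N - 1)) * g ((renyi_map N ^^ Suc n) y) * indicator {0..1} y \<partial>lborel) =
    (\<integral>\<^sup>+ s. ennreal ((renyi_op N ^^ n) f s / (s + real N - 1)) * g (renyi_map N s) * indicator {0..1} s \<partial>lborel)"
    using Suc.IH[of "\<lambda>y. g (renyi_map N y)"] by simp
  also have "\<dots> = (\<integral>\<^sup>+ s. ennreal ((renyi_op N ^^ Suc n) f s / (s + real N - 1)) * g s * indicator {0..1} s \<partial>lborel)"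
    using renyi_transfer[OF N renyi_op_iter_mono_on[OF N f(1)] renyi_op_iter_nonneg[OF N f] Suc.prems] by simp
  finally show ?case .
qed simp

section \<open>The test function and its image under the operator\<close>

text \<open>
  With \<open>b = (t + 1) / e\<close> the function \<open>phi N e t\<close> is \<open>- test_fun N b / e\<close>, and
  \<open>test_prim\<close> is a primitive of \<open>test_fun\<close>.  It is chosen for its values at the inverse
  branches: at \<open>x = 1 - N / y\<close> it equals \<open>- A / (y - A) - (2 - A) / (y - A + 1)\<close> with
  \<open>A = N - b\<close>, and these values make the series of the operator telescope.
\<close>

definition test_prim :: "nat \<Rightarrow> real \<Rightarrow> real \<Rightarrow> real" where
  "test_prim N b x = - (1 - x) * ((real N - b) / ((real N - b) * x + b)
     + (2 - real N + b) / ((real N - b - 1) * x + b + 1))"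

definition test_fun :: "nat \<Rightarrow> real \<Rightarrow> real \<Rightarrow> real" where
  "test_fun N b x = real N * ((real N - b) / ((real N - b) * x + b)\<^sup>2
     + (2 - real N + b) / ((real N - b - 1) * x + b + 1)\<^sup>2)"

lemma phi_eq_test_fun:
  assumes "e > 0"
  shows "phi N e t x = - test_fun N ((t + 1) / e) x / e"
proof -
  define b where "b = (t + 1) / e"
  have t: "t + 1 = e * b" using assms by (simp add: b_def)
  have t': "t = e * b - 1" using t by simp
  define D1 where "D1 = (real N - b) * x + b"
  define D2 where "D2 = (real N - b - 1) * x + b + 1"
  have 1: "e * real N * x + (t + 1) * (1 - x) = e * D1"
    by (simp add: t' D1_def algebra_simps)
  have 2: "e * (real N * x + 1 - x) + (t + 1) * (1 - x) = e * D2"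
    by (simp add: t' D2_def algebra_simps)
  have 3: "e * real N - t - 1 = e * (real N - b)" "2 * e - e * (real N - b) = e * (2 - real N + b)"
    by (simp_all add: t' algebra_simps)
  have q: "e * z / (e * d)\<^sup>2 = (z / d\<^sup>2) / e" for z d
    using assms by (simp add: power2_eq_square)
  have lin: "- n * (P / e) - n * (Q / e) = - (n * (P + Q)) / e" for n P Q :: real
    by (simp add: divide_inverse algebra_simps)
  have "phi N e t x = - real N * (e * (real N - b) / (e * D1)\<^sup>2) - real N * (e * (2 - real N + b) / (e * D2)\<^sup>2)"
    unfolding phi_def 1 2 3 by simp
  also have "\<dots> = - test_fun N b x / e"
    unfolding q test_fun_def D1_def[symmetric] D2_def[symmetric] by (rule lin)
  finally show ?thesis by (simp add: b_def)
qed

text \<open>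
  After division by \<open>e ^ 4\<close> the equation for \<open>t\<close> depends only on \<open>b\<close>.
\<close>

lemma root_equation:
  assumes "e > 0" "H_poly N e t = 0" "b = (t + 1) / e"
  shows "2 * (b + 1) ^ 4 = (real N)\<^sup>2 * (2 * real N - 1) * b + real N ^ 3"
proof -
  have t: "t + 1 = e * b" using assms by simp
  then have "t + e + 1 = e * (b + 1)" by (simp add: algebra_simps)
  with t assms(2) have "2 * (e * (b + 1)) ^ 4 + e ^ 3 * (real N)\<^sup>2 * (1 - 2 * real N) * (e * b) - e ^ 4 * real N ^ 3 = 0"
    by (simp add: H_poly_def)
  then have "e ^ 4 * (2 * (b + 1) ^ 4 - ((real N)\<^sup>2 * (2 * real N - 1) * b + real N ^ 3)) = 0"
    by (simp add: power_mult_distrib algebra_simps power3_eq_cube power4_eq_xxxx)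
  then show ?thesis using assms(1) by simp
qed

text \<open>
  For \<open>b \<ge> N - 1\<close> the left-hand side of the equation exceeds the right-hand side, and for
  \<open>0 < b \<le> N - 2\<close> it is smaller.  The bounds say that \<open>A = N - b\<close> lies in \<open>(1,2)\<close>, so that both numerators \<open>A\<close> and
  \<open>2 - A\<close> of \<open>test_fun\<close> are positive and the terms behave monotonically.
\<close>

lemma root_bounds:
  assumes N: "N \<ge> 2" and b: "b > 0" and eq: "2 * (b + 1) ^ 4 = (real N)\<^sup>2 * (2 * real N - 1) * b + real N ^ 3"
  shows "real N - 2 < b" "b < real N - 1"
proof -
  define M where "M = real N"
  have M: "M \<ge> 2" using N by (simp add: M_def)
  have e: "2 * (b + 1) ^ 4 = M\<^sup>2 * (2 * M - 1) * b + M ^ 3" using eq by (simp add: M_def)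
  show "b < real N - 1"
  proof (rule ccontr)
    assume "\<not> b < real N - 1"
    then have l: "M \<le> b + 1" by (simp add: M_def)
    have "M ^ 3 * (b + 1) \<le> (b + 1) ^ 3 * (b + 1)"
      using l M by (intro mult_right_mono power_mono) auto
    then have "2 * M ^ 3 * (b + 1) \<le> 2 * (b + 1) ^ 4" by (simp add: power4_eq_xxxx power3_eq_cube)
    with e have "M\<^sup>2 * (M + b) \<le> 0" by (simp add: algebra_simps power2_eq_square power3_eq_cube)
    moreover have "M\<^sup>2 * (M + b) > 0" using M b by (intro mult_pos_pos) auto
    ultimately show False by simp
  qed
  show "real N - 2 < b"
  proof (rule ccontr)
    assume "\<not> real N - 2 < b"
    then have l: "b + 1 \<le> M - 1" by (simp add: M_def)
    define s where "s = b + 1"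
    have s: "s > 1" "s \<le> M - 1" using b l by (auto simp: s_def)
    \<comment> \<open>\<open>s\<^sup>4\<close> is bounded linearly in \<open>s\<close>, using \<open>s\<^sup>2 \<le> (M - 1)\<^sup>2\<close> and \<open>(s - 1) (M - 1 - s) \<ge> 0\<close>\<close>
    have s2: "s\<^sup>2 \<le> M * s - (M - 1)"
      using mult_nonneg_nonneg[of "s - 1" "M - 1 - s"] s by (simp add: algebra_simps power2_eq_square)
    have "s\<^sup>2 \<le> (M - 1)\<^sup>2" using s by (intro power_mono) auto
    then have "s\<^sup>2 * s\<^sup>2 \<le> (M - 1)\<^sup>2 * (M * s - (M - 1))"
      using s2 by (intro mult_mono) auto
    then have "s ^ 4 \<le> (M - 1)\<^sup>2 * (M * s - (M - 1))" by (simp add: power4_eq_xxxx power2_eq_square)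
    with e have "M\<^sup>2 * (2 * M - 1) * (s - 1) + M ^ 3 \<le> 2 * ((M - 1)\<^sup>2 * (M * s - (M - 1)))"
      by (simp add: s_def)
    then have "s * (M * (3 * M - 2)) + 2 * (M - 1) ^ 3 \<le> M ^ 3 - M\<^sup>2"
      by (simp add: algebra_simps power2_eq_square power3_eq_cube)
    moreover have "1 * (M * (3 * M - 2)) \<le> s * (M * (3 * M - 2))"
      using s M by (intro mult_right_mono) auto
    moreover have "2 * (M * M) \<le> M * (M * M)" using M by (intro mult_right_mono) auto
    ultimately show False using M by (simp add: algebra_simps power2_eq_square power3_eq_cube)
  qed
qed

lemma test_denoms_pos:
  assumes "N \<ge> 2" "b > 0" "real N - 2 < b" "b < real N - 1" "x \<in> {0..1}"
  shows "(real N - b) * x + b > 0" "(real N - b - 1) * x + b + 1 > 0"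
  using assms by (auto intro!: add_nonneg_pos)

lemma test_prim_deriv:
  assumes "N \<ge> 2" "b > 0" "real N - 2 < b" "b < real N - 1" "x \<in> {0..1}"
  shows "(test_prim N b has_real_derivative test_fun N b x) (at x within S)"
proof -
  note d = test_denoms_pos[OF assms]
  define A where "A = real N - b"
  have N: "real N = A + b" by (simp add: A_def)
  have d': "A * x + b > 0" "(A - 1) * x + b + 1 > 0" using d by (auto simp: A_def)
  have q: "((\<lambda>x. - (1 - x) * (c / (m * x + d))) has_real_derivative (m + d) * (c / (m * x + d)\<^sup>2)) (at x within S)"
    if "m * x + d > 0" for c m d
    using that by (auto intro!: derivative_eq_intros simp: divide_simps power2_eq_square) (simp add: algebra_simps)
  have "((\<lambda>x. - (1 - x) * (A / (A * x + b)) + - (1 - x) * ((2 - A) / ((A - 1) * x + (b + 1)))) has_real_derivative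
      (A + b) * (A / (A * x + b)\<^sup>2) + ((A - 1) + (b + 1)) * ((2 - A) / ((A - 1) * x + (b + 1))\<^sup>2)) (at x within S)"
    using d' by (intro DERIV_add q) (auto simp: algebra_simps)
  moreover have "(A + b) * (A / (A * x + b)\<^sup>2) + ((A - 1) + (b + 1)) * ((2 - A) / ((A - 1) * x + (b + 1))\<^sup>2) = test_fun N b x"
    unfolding test_fun_def N by (simp add: algebra_simps)
  moreover have "test_prim N b = (\<lambda>x. - (1 - x) * (A / (A * x + b)) + - (1 - x) * ((2 - A) / ((A - 1) * x + (b + 1))))"
    unfolding test_prim_def A_def by (simp add: fun_eq_iff algebra_simps)
  ultimately show ?thesis by simp
qed

lemma test_fun_cont:
  assumes "N \<ge> 2" "b > 0" "real N - 2 < b" "b < real N - 1"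
  shows "continuous_on {0..1} (test_fun N b)"
  unfolding test_fun_def using test_denoms_pos[OF assms] by (intro continuous_intros) force+

text \<open>
  Both denominators are estimated from above, by \<open>D = x + N - 1\<close> and by \<open>N\<close>.  Because
  of \<open>D \<le> N\<close> the resulting bound is smallest for \<open>A = 1\<close>, where it reduces to the
  inequality of arithmetic and geometric means for \<open>1 / D\<^sup>2\<close> and \<open>1 / N\<^sup>2\<close>.  There is
  equality at \<open>x = 1\<close>.  So the factor \<open>x + N - 1\<close> of the invariant measure, although it is
  smaller than \<open>N\<close> on \<open>[0,1)\<close>, may be replaced by \<open>N\<close> in the lower error bound if
  \<open>test_fun\<close> is replaced by its value at \<open>1\<close>.
\<close>

lemma test_fun_lower:
  assumes "N \<ge> 2" "b > 0" "real N - 2 < b" "b < real N - 1" "x \<in> {0..1}"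
  shows "test_fun N b x * (x + real N - 1) \<ge> 2"
proof -
  note d = test_denoms_pos[OF assms]
  define A where "A = real N - b"
  have N: "real N = A + b" by (simp add: A_def)
  define D where "D = x + real N - 1"
  have A: "1 < A" "A < 2" using assms by (auto simp: A_def)
  have D: "D > 0" "D \<le> real N" using assms by (auto simp: D_def)
  have 1: "(real N - b) * x + b \<le> D"
  proof -
    have "D - ((real N - b) * x + b) = (A - 1) * (1 - x)" by (simp add: D_def N algebra_simps)
    also have "\<dots> \<ge> 0" using A assms by auto
    finally show ?thesis by simp
  qed
  have 2: "(real N - b - 1) * x + b + 1 \<le> real N"
  proof -
    have "real N - ((real N - b - 1) * x + b + 1) = (A - 1) * (1 - x)" by (simp add: N algebra_simps)
    also have "\<dots> \<ge> 0" using A assms by auto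
    finally show ?thesis by simp
  qed
  have i1: "A / ((real N - b) * x + b)\<^sup>2 \<ge> A / D\<^sup>2"
    using 1 d A D by (intro divide_left_mono power_mono) auto
  have A2: "2 - real N + b = 2 - A" by (simp add: A_def)
  have i2: "(2 - real N + b) / ((real N - b - 1) * x + b + 1)\<^sup>2 \<ge> (2 - A) / (real N)\<^sup>2"
    unfolding A2 using 2 d A D by (intro divide_left_mono power_mono) auto
  have "1 / (real N)\<^sup>2 \<le> 1 / D\<^sup>2" using D by (intro divide_left_mono power_mono) auto
  then have "(A - 1) * (1 / (real N)\<^sup>2) \<le> (A - 1) * (1 / D\<^sup>2)" using A by (intro mult_left_mono) auto
  then have i3: "A / D\<^sup>2 + (2 - A) / (real N)\<^sup>2 \<ge> 1 / D\<^sup>2 + 1 / (real N)\<^sup>2"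
    by (simp add: algebra_simps diff_divide_distrib)
  have i4: "1 / D\<^sup>2 + 1 / (real N)\<^sup>2 \<ge> 2 / (D * real N)"
  proof -
    have "0 \<le> (1 / D - 1 / real N)\<^sup>2" by simp
    then show ?thesis by (simp add: power2_diff power_divide)
  qed
  have "2 = real N * (2 / (D * real N)) * D" using D assms by simp
  also have "\<dots> \<le> test_fun N b x * D" unfolding test_fun_def
    using i1 i2 i3 i4 D assms by (intro mult_right_mono mult_left_mono) (auto simp: A_def)
  finally show ?thesis by (simp add: D_def)
qed

lemma test_fun_pos:
  assumes "N \<ge> 2" "b > 0" "real N - 2 < b" "b < real N - 1" "x \<in> {0..1}"
  shows "test_fun N b x > 0"
proof -
  have "0 < test_fun N b x * (x + real N - 1)" using test_fun_lower[OF assms] by linarith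
  moreover have "x + real N - 1 > 0" using assms by auto
  ultimately show ?thesis by (simp add: zero_less_mult_iff)
qed

lemma test_prim_mono_on:
  assumes "N \<ge> 2" "b > 0" "real N - 2 < b" "b < real N - 1"
  shows "mono_on {0..1} (test_prim N b)"
  using test_prim_deriv[OF assms] test_fun_pos[OF assms]
  by (intro mono_on_unit_if_deriv_nonneg[where g' = "test_fun N b"]) (auto intro: less_imp_le)

lemma test_fun_1: "N \<ge> 2 \<Longrightarrow> test_fun N b 1 = 2 / real N"
  by (simp add: test_fun_def power2_eq_square add_divide_distrib[symmetric])

text \<open>
  The quotient of \<open>test_fun\<close> and its image is largest at the end points of \<open>[0,1]\<close>; the
  equation for \<open>b\<close> says exactly that the two end values agree.  With the fractions
  \<open>p\<close> (decreasing) and \<open>r\<close> (increasing), which have the common value \<open>k\<close> at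
  \<open>1\<close>, the quotient is a multiple of \<open>A p\<^sup>2 + (2 - A) r\<^sup>2\<close>.  Its distance from the value
  at \<open>1\<close> is \<open>1 - x\<close> times a difference of two positive terms whose quotient is
  monotone.  The difference vanishes at \<open>0\<close>, hence is nonnegative on \<open>[0,1]\<close>.
\<close>

lemma test_ratio_le:
  assumes "N \<ge> 2" "b > 0" "real N - 2 < b" "b < real N - 1" "x \<in> {0..1}"
    and eq: "2 * (b + 1) ^ 4 = (real N)\<^sup>2 * (2 * real N - 1) * b + real N ^ 3"
  shows "test_fun N b x * (x + b)\<^sup>2 \<le> 2 * (b + 1)\<^sup>2 / real N"
proof -
  define A where "A = real N - b"
  have N: "real N = A + b" by (simp add: A_def)
  have A: "1 < A" "A < 2" using assms by (auto simp: A_def)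
  define D1 where "D1 = (\<lambda>x. A * x + b)"
  define D2 where "D2 = (\<lambda>x. (A - 1) * x + b + 1)"
  have d: "D1 x > 0" "D2 x > 0" if "x \<in> {0..1}" for x
    using test_denoms_pos[OF assms(1-4) that] by (auto simp: A_def D1_def D2_def)
  define k where "k = (1 + b) / (A + b)"
  define p where "p = (\<lambda>x. (x + b) / D1 x)"
  define r where "r = (\<lambda>x. (x + b) / D2 x)"
  have Ab: "A + b > 0" using A assms by simp
  have k: "k > 0" using assms Ab by (simp add: k_def)
  define c1 where "c1 = A * b * (A - 1)"
  define c2 where "c2 = (2 - A) * (1 + b * (2 - A))"
  have c: "c1 > 0" "c2 > 0" using A assms by (auto simp: c1_def c2_def intro!: mult_pos_pos add_pos_pos)
  have pk: "p x - k = (1 - x) * (b * (A - 1)) / ((A + b) * D1 x)" if "x \<in> {0..1}" for x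
    using d[OF that] Ab unfolding p_def k_def
    by (simp add: divide_simps) (simp add: D1_def algebra_simps)
  have kr: "k - r x = (1 - x) * (1 + b * (2 - A)) / ((A + b) * D2 x)" if "x \<in> {0..1}" for x
    using d[OF that] Ab unfolding r_def k_def
    by (simp add: divide_simps) (simp add: D2_def algebra_simps)
  have p0: "p x + k > 0" "r x + k > 0" if "x \<in> {0..1}" for x
    using d[OF that] k that assms by (auto simp: p_def r_def intro!: add_nonneg_pos)
  have factor: "2 * k\<^sup>2 - (A * (p x)\<^sup>2 + (2 - A) * (r x)\<^sup>2) =
      (1 - x) / (A + b) * (c2 * (r x + k) / D2 x - c1 * (p x + k) / D1 x)" if "x \<in> {0..1}" for x
  proof -
    have "2 * k\<^sup>2 - (A * (p x)\<^sup>2 + (2 - A) * (r x)\<^sup>2) = (2 - A) * (k - r x) * (r x + k) - A * (p x - k) * (p x + k)"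
      by (simp add: algebra_simps power2_eq_square)
    also have "\<dots> = (1 - x) / (A + b) * (c2 * (r x + k) / D2 x - c1 * (p x + k) / D1 x)"
      unfolding pk[OF that] kr[OF that] c1_def c2_def by (simp add: algebra_simps diff_divide_distrib add_divide_distrib)
    finally show ?thesis .
  qed
  \<comment> \<open>the end values agree, by the equation for \<open>b\<close>\<close>
  have zero: "2 * k\<^sup>2 - (A * (p 0)\<^sup>2 + (2 - A) * (r 0)\<^sup>2) = 0"
  proof -
    have "(A * (p 0)\<^sup>2 + (2 - A) * (r 0)\<^sup>2) = A + (2 - A) * b\<^sup>2 / (b + 1)\<^sup>2"
      using assms by (simp add: p_def r_def D1_def D2_def power_divide)
    also have "\<dots> = ((2 * (A + b) - 1) * b + (A + b)) / (b + 1)\<^sup>2"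
      using assms by (simp add: divide_simps) (simp add: algebra_simps power2_eq_square)
    also have "\<dots> = ((A + b)\<^sup>2 * (2 * (A + b) - 1) * b + (A + b) ^ 3) / ((A + b)\<^sup>2 * (b + 1)\<^sup>2)"
      using assms Ab by (simp add: divide_simps) (simp add: algebra_simps power2_eq_square power3_eq_cube)
    also have "\<dots> = 2 * (b + 1) ^ 4 / ((A + b)\<^sup>2 * (b + 1)\<^sup>2)" using eq by (simp add: N)
    also have "\<dots> = 2 * k\<^sup>2" using assms Ab
      by (simp add: k_def power_divide divide_simps) (simp add: algebra_simps power2_eq_square power4_eq_xxxx)
    finally show ?thesis by simp
  qed
  have F0: "c2 * (r 0 + k) / D2 0 = c1 * (p 0 + k) / D1 0"
    using factor[of 0] zero Ab by simp
  have dd: "D1 0 / D2 0 \<le> D1 x / D2 x"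
    using d[of 0] d[of x] assms A by (simp add: divide_simps) (simp add: D1_def D2_def algebra_simps mult_left_mono)
  have x0: "x \<ge> 0" using assms by simp
  have "A * (b * x) \<le> 2 * (b * x)" using A assms by (intro mult_right_mono) auto
  then have "A * (b * x) \<le> x + b * (x * 2)" using x0 by linarith
  then have r: "r 0 \<le> r x"
    using d[of 0] d[of x] assms A unfolding r_def by (simp add: divide_simps) (simp add: D1_def D2_def algebra_simps)
  have "x \<le> A * x" using A x0 by (simp add: mult_le_cancel_right1)
  then have p: "p x \<le> p 0"
    using d[of 0] d[of x] assms A unfolding p_def by (simp add: divide_simps) (simp add: D1_def D2_def algebra_simps)
  have "c1 * (p x + k) / D1 x \<le> c2 * (r x + k) / D2 x"
  proof -
    have "c1 * (p x + k) \<le> c1 * (p 0 + k)" using p c by simp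
    also have "\<dots> = c2 * (r 0 + k) * (D1 0 / D2 0)" using F0 d[of 0] by (simp add: field_simps)
    also have "\<dots> \<le> c2 * (r x + k) * (D1 x / D2 x)"
      using dd r c p0[of 0] p0[of x] d[of 0] assms by (intro mult_mono) (auto intro: less_imp_le)
    finally show ?thesis using d[of x] assms by (simp add: field_simps)
  qed
  with factor[of x] have "A * (p x)\<^sup>2 + (2 - A) * (r x)\<^sup>2 \<le> 2 * k\<^sup>2"
    using assms Ab by (smt (verit) atLeastAtMost_iff divide_nonneg_pos mult_nonneg_nonneg)
  then have "(A + b) * (A * (p x)\<^sup>2 + (2 - A) * (r x)\<^sup>2) \<le> (A + b) * (2 * k\<^sup>2)"
    using Ab by (intro mult_left_mono) auto
  also have "(A + b) * (2 * k\<^sup>2) = 2 * (b + 1)\<^sup>2 / real N"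
    using Ab unfolding N k_def by (simp add: power_divide power2_eq_square add.commute)
  also have "(A + b) * (A * (p x)\<^sup>2 + (2 - A) * (r x)\<^sup>2) = test_fun N b x * (x + b)\<^sup>2"
    unfolding test_fun_def N p_def r_def D1_def D2_def by (simp add: power_divide algebra_simps)
  finally show ?thesis .
qed

text \<open>
  The terms of the operator applied to \<open>test_prim\<close> telescope by a partial fraction
  decomposition in \<open>y = x + N + k\<close>.
\<close>

lemma test_prim_inv_branch:
  assumes "N \<ge> 2" "b > 0" "x \<in> {0..1}"
  shows "branch_prob N k x * test_prim N b (inv_branch N (N + k) x) =
     (x + real N - 1) / ((x + b + real (Suc k)) * (x + real N + real (Suc k) - 1)) -
     (x + real N - 1) / ((x + b + real k) * (x + real N + real k - 1))"
proof -
  define y where "y = x + real N + real k"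
  define A where "A = real N - b"
  have N: "real N = A + b" by (simp add: A_def)
  have y: "y > 0" "y - 1 > 0" "y - A > 0" "y - A + 1 > 0" using assms by (auto simp: y_def A_def)
  have Np: "real N > 0" using assms by simp
  have u: "inv_branch N (N + k) x = 1 - real N / y" by (simp add: inv_branch_alt y_def)
  have D: "A * (1 - real N / y) + b = real N * (y - A) / y" "(A - 1) * (1 - real N / y) + b + 1 = real N * (y - A + 1) / y"
    using y by (simp_all add: N field_simps)
  have cancel: "real N / y * (c / (real N * d / y)) = c / d" if "d > 0" for c d
    using that y Np by simp
  have split: "- r * (P + Q) = - (r * P) - r * Q" for r P Q :: real by (simp add: algebra_simps)
  have "test_prim N b (1 - real N / y) = - (real N / y) * (A / (A * (1 - real N / y) + b) + (2 - A) / ((A - 1) * (1 - real N / y) + b + 1))"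
    by (simp add: test_prim_def A_def)
  also have "\<dots> = - (A / (y - A)) - (2 - A) / (y - A + 1)"
    unfolding D split by (subst (1 2) cancel) (use y in auto)
  finally have g: "test_prim N b (inv_branch N (N + k) x) = - (A / (y - A)) - (2 - A) / (y - A + 1)" unfolding u .
  have pf: "1 / (y * (y - 1)) * (- (A / (y - A)) - (2 - A) / (y - A + 1)) = 1 / ((y - A + 1) * y) - 1 / ((y - A) * (y - 1))"
    using y by (simp add: divide_simps) (simp add: algebra_simps)
  have "branch_prob N k x * test_prim N b (inv_branch N (N + k) x) = (x + real N - 1) * (1 / (y * (y - 1)) * (- (A / (y - A)) - (2 - A) / (y - A + 1)))"
    unfolding g branch_prob_def y_def[symmetric] by simp
  also have "\<dots> = (x + real N - 1) / ((y - A + 1) * y) - (x + real N - 1) / ((y - A) * (y - 1))"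
    unfolding pf by (simp add: algebra_simps)
  finally show ?thesis by (simp add: y_def A_def algebra_simps)
qed

lemma renyi_op_test_prim:
  assumes "N \<ge> 2" "b > 0" "x \<in> {0..1}"
  shows "renyi_op N (test_prim N b) x = - 1 / (x + b)"
proof -
  define T where "T = (\<lambda>k. (x + real N - 1) / ((x + b + real k) * (x + real N + real k - 1)))"
  have "T \<longlonglongrightarrow> 0" unfolding T_def by real_asymp
  then have "(\<lambda>k. T (Suc k) - T k) sums (0 - T 0)" by (rule telescope_sums)
  moreover have "T 0 = 1 / (x + b)" using assms by (simp add: T_def)
  ultimately show ?thesis
    unfolding renyi_op_def test_prim_inv_branch[OF assms] T_def by (simp add: sums_iff)
qed

lemma branch_prob_deriv:
  assumes "x + real N + real k > 1"
  shows "(branch_prob N k has_real_derivative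
     real k / (x + real N + real k - 1)\<^sup>2 - real (Suc k) / (x + real N + real k)\<^sup>2) (at x within S)"
proof -
  have eq: "branch_prob N k z = real (Suc k) / (z + real N + real k) - real k / (z + real N + real k - 1)" if "z + real N + real k > 1" for z
    unfolding branch_prob_def using that by (simp add: divide_simps) (simp add: algebra_simps)
  have "((\<lambda>z. real (Suc k) / (z + real N + real k) - real k / (z + real N + real k - 1)) has_real_derivative
     real k / (x + real N + real k - 1)\<^sup>2 - real (Suc k) / (x + real N + real k)\<^sup>2) (at x)"
    using assms by (auto intro!: derivative_eq_intros simp: power2_eq_square) (simp add: divide_inverse algebra_simps)
  then have "(branch_prob N k has_real_derivative
     real k / (x + real N + real k - 1)\<^sup>2 - real (Suc k) / (x + real N + real k)\<^sup>2) (at x)"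
  proof (rule has_field_derivative_transform_within_open)
    show "open {1 - real N - real k <..}" by simp
  qed (use assms eq in auto)
  then show ?thesis by (rule has_field_derivative_at_within)
qed

text \<open>
  The series is the derivative of the one in \<open>renyi_op_test_prim\<close>.  The terms with the integrals arise
  from summation by parts in the derivatives of the weights.  Undoing it, a term is a difference
  of consecutive values of \<open>E\<close>, the boundary terms, plus a difference of consecutive
  values of \<open>T'\<close>, the derivatives of the telescoping sequence from \<open>test_prim_inv_branch\<close>.
  As all terms are nonnegative, the unordered sum is the limit of the partial sums.
\<close>

lemma V_op_test_fun:
  assumes N: "N \<ge> 2" and b: "b > 0" "real N - 2 < b" "b < real N - 1" and x: "x \<in> {0..1}"
  shows "V_op N (\<lambda>u. - c * test_fun N b u) x = c / (x + b)\<^sup>2"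
proof -
  let ?u = "\<lambda>k. inv_branch N (N + k) x"
  define tm where "tm = (\<lambda>k. real (Suc k) / (x + real N + real k)\<^sup>2 * (test_prim N b (?u (Suc k)) - test_prim N b (?u k))
     + branch_prob N k x * (real N / (x + real N + real k)\<^sup>2) * test_fun N b (?u k))"
  have u: "?u k \<in> {0..1}" for k using inv_branch_in_unit[OF N x] .
  have le: "?u k \<le> ?u (Suc k)" for k using inv_branch_Suc_ge[OF N, of x k] x by simp
  have pos: "test_fun N b z \<ge> 0" if "z \<in> {0..1}" for z
    using test_fun_pos[OF N b that] by simp
  have int: "(test_fun N b has_integral test_prim N b (?u (Suc k)) - test_prim N b (?u k)) {?u k..?u (Suc k)}" for k
  proof (rule fundamental_theorem_of_calculus[OF le])
    fix z assume "z \<in> {?u k..?u (Suc k)}"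
    with u[of k] u[of "Suc k"] have "z \<in> {0..1}" by auto
    then show "(test_prim N b has_vector_derivative test_fun N b z) (at z within {?u k..?u (Suc k)})"
      using test_prim_deriv[OF N b] by (simp flip: has_real_derivative_iff_has_vector_derivative)
  qed
  have tm_nonneg: "tm k \<ge> 0" for k
  proof -
    have "test_prim N b (?u (Suc k)) - test_prim N b (?u k) \<ge> 0"
      using mono_onD[OF test_prim_mono_on[OF N b] u u le] by simp
    then show ?thesis unfolding tm_def
      using pos[OF u] branch_prob_nonneg[OF N, of x k] x
      by (intro add_nonneg_nonneg mult_nonneg_nonneg) auto
  qed
  define T where "T = (\<lambda>k z. (z + real N - 1) / ((z + b + real k) * (z + real N + real k - 1)))"
  define T' where "T' = (\<lambda>k. real k / ((x + real N + real k - 1)\<^sup>2 * (x + b + real k)) - (x + real N - 1) / ((x + b + real k)\<^sup>2 * (x + real N + real k - 1)))"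
  have T': "(T k has_real_derivative T' k) (at x within {0..1})" for k
  proof -
    define X Y M where "X = x + b + real k" and "Y = x + real N + real k - 1" and "M = x + real N - 1"
    have p: "X > 0" "Y > 0" using N b x by (auto simp: X_def Y_def)
    have "(T k has_real_derivative (1 * (X * Y) - M * (1 * Y + 1 * X)) / (X * Y * (X * Y))) (at x within {0..1})"
      unfolding T_def X_def Y_def M_def using p
      by (intro DERIV_divide DERIV_mult) (auto intro!: derivative_eq_intros simp: X_def Y_def)
    also have "(1 * (X * Y) - M * (1 * Y + 1 * X)) / (X * Y * (X * Y)) = (Y - M) / (Y\<^sup>2 * X) - M / (X\<^sup>2 * Y)"
      using p by (simp add: field_simps power2_eq_square)
    also have "\<dots> = T' k" by (simp add: T'_def X_def Y_def M_def)
    finally show ?thesis .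
  qed
  define E where "E = (\<lambda>k. real k / (x + real N + real k - 1)\<^sup>2 * test_prim N b (?u k))"
  have tm_eq: "tm k = (E (Suc k) - E k) + (T' (Suc k) - T' k)" for k
  proof -
    let ?P' = "real k / (x + real N + real k - 1)\<^sup>2 - real (Suc k) / (x + real N + real k)\<^sup>2"
    have "((\<lambda>z. branch_prob N k z * test_prim N b (inv_branch N (N + k) z)) has_real_derivative
       ?P' * test_prim N b (?u k) + (test_fun N b (?u k) * (real N / (x + real N + real k)\<^sup>2)) * branch_prob N k x) (at x within {0..1})"
      using N x u[of k] by (intro DERIV_mult branch_prob_deriv DERIV_chain2[OF test_prim_deriv] inv_branch_deriv b) auto
    moreover have "((\<lambda>z. branch_prob N k z * test_prim N b (inv_branch N (N + k) z)) has_real_derivative T' (Suc k) - T' k) (at x within {0..1})"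
    proof (rule has_field_derivative_transform_within[OF DERIV_diff[OF T' T'] zero_less_one x])
      fix z :: real assume "z \<in> {0..1}"
      then show "T (Suc k) z - T k z = branch_prob N k z * test_prim N b (inv_branch N (N + k) z)"
        unfolding T_def using test_prim_inv_branch[OF N b(1)] by simp
    qed
    ultimately have "?P' * test_prim N b (?u k) + (test_fun N b (?u k) * (real N / (x + real N + real k)\<^sup>2)) * branch_prob N k x = T' (Suc k) - T' k"
      using x by (intro vector_derivative_unique_within_closed_interval[of 0 1 x])
        (auto simp flip: has_real_derivative_iff_has_vector_derivative)
    moreover have "E (Suc k) = real (Suc k) / (x + real N + real k)\<^sup>2 * test_prim N b (?u (Suc k))"
      by (simp add: E_def algebra_simps)
    ultimately show ?thesis unfolding tm_def E_def by (simp add: algebra_simps)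
  qed
  note mono = test_prim_mono_on[OF N b]
  have E0: "E \<longlonglongrightarrow> 0" unfolding E_def
  proof (rule lim_null_mult_right_bounded)
    show "(\<lambda>k. real k / (x + real N + real k - 1)\<^sup>2) \<longlonglongrightarrow> 0" by real_asymp
    show "\<forall>\<^sub>F k in sequentially. norm (test_prim N b (?u k)) \<le> \<bar>test_prim N b 0\<bar> + \<bar>test_prim N b 1\<bar>"
      using mono_on_unit_bounded[OF mono u] by simp
  qed
  have T0: "T' \<longlonglongrightarrow> 0" unfolding T'_def by real_asymp
  have "tm sums ((0 - E 0) + (0 - T' 0))"
    unfolding tm_eq by (intro sums_add telescope_sums E0 T0)
  moreover have "T' 0 = - 1 / (x + b)\<^sup>2" "E 0 = 0" using N x b by (simp_all add: T'_def E_def)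
  ultimately have "tm sums (1 / (x + b)\<^sup>2)" by simp
  then have "(tm has_sum (1 / (x + b)\<^sup>2)) UNIV"
    using tm_nonneg by (intro norm_summable_imp_has_sum) (auto simp: sums_iff)
  then have hs: "((\<lambda>k. - c * tm k) has_sum (- c * (1 / (x + b)\<^sup>2))) UNIV" by (rule has_sum_cmult_right)
  have V: "V_op N (\<lambda>u. - c * test_fun N b u) x = - (\<Sum>\<^sub>\<infinity>i\<in>(+) N ` UNIV. (real i + 1 - real N) / (x + real i)\<^sup>2
            * integral {inv_branch N i x..inv_branch N (i + 1) x} (\<lambda>u. - c * test_fun N b u)
        + real N * (x + real N - 1) / ((x + real i - 1) * (x + real i) ^ 3)
            * (- c * test_fun N b (inv_branch N i x)))"
  proof -
    have "{N..} = (+) N ` UNIV" by (auto simp: image_iff le_iff_add)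
    then show ?thesis unfolding V_op_def by simp
  qed
  also have "\<dots> = - (\<Sum>\<^sub>\<infinity>k. - c * tm k)"
  proof -
    have "(real (N + k) + 1 - real N) / (x + real (N + k))\<^sup>2
            * integral {inv_branch N (N + k) x..inv_branch N (N + k + 1) x} (\<lambda>u. - c * test_fun N b u)
        + real N * (x + real N - 1) / ((x + real (N + k) - 1) * (x + real (N + k)) ^ 3)
            * (- c * test_fun N b (inv_branch N (N + k) x)) = - c * tm k" for k
    proof -
      have e: "N + k + 1 = N + Suc k" by simp
      have I: "integral {inv_branch N (N + k) x..inv_branch N (N + k + 1) x} (\<lambda>u. - c * test_fun N b u) = - c * (test_prim N b (?u (Suc k)) - test_prim N b (?u k))"
        unfolding e by (rule integral_unique[OF has_integral_mult_right[OF int]])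
      have gen: "r / X\<^sup>2 * (- c * d) + n * m / (Y * X ^ 3) * (- c * h) = - c * (r / X\<^sup>2 * d + m / (X * Y) * (n / X\<^sup>2) * h)"
        for r X d n m Y h :: real
        by (simp add: divide_inverse power2_eq_square power3_eq_cube algebra_simps)
      have r: "real (N + k) + 1 - real N = real (Suc k)" "x + real (N + k) = x + real N + real k" by simp_all
      show ?thesis unfolding I r tm_def branch_prob_def by (rule gen)
    qed
    then show ?thesis by (subst infsum_reindex) (auto simp: o_def)
  qed
  also have "\<dots> = c / (x + b)\<^sup>2" using infsumI[OF hs] by simp
  finally show ?thesis .
qed

section \<open>From monotone densities to distribution functions\<close>

lemma integrable_mono_on_weight:
  fixes k w :: "real \<Rightarrow> real"
  assumes k: "mono_on {0..1} k" and w: "w integrable_on {0..1}" and ab: "0 \<le> a" "a \<le> b" "b \<le> 1"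
  shows "(\<lambda>u. k u * w u) integrable_on {a..b}"
proof -
  have wi: "w integrable_on {a..b}" by (rule integrable_on_subinterval[OF w]) (use ab in auto)
  have mono: "k x \<le> k y" if "a \<le> x" "x \<le> y" "y \<le> b" for x y
    using that ab by (intro mono_onD[OF k]) auto
  obtain c where "((\<lambda>u. k u * w u) has_integral (k a * integral {a..c} w + k b * integral {c..b} w)) {a..b}"
    using second_mean_value_theorem_full[where g = k, OF wi ab(2) mono] by blast
  then show ?thesis by blast
qed

text \<open>
  A special case of Chebyshev's sum inequality: the mean of an increasing function over an initial
  segment is at most its value \<open>k x\<close> at the right end point of the segment, which is at
  most the mean over the rest of the interval.
\<close>

lemma chebyshev_initial_segment:
  fixes k w :: "real \<Rightarrow> real"
  assumes k: "mono_on {0..1} k" and w: "w integrable_on {0..1}" "\<And>u. u \<in> {0..1} \<Longrightarrow> w u \<ge> 0"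
    and x: "x \<in> {0..1}"
  shows "integral {0..1} w * integral {0..x} (\<lambda>u. k u * w u) \<le> integral {0..x} w * integral {0..1} (\<lambda>u. k u * w u)"
proof -
  have wi: "w integrable_on {0..x}" "w integrable_on {x..1}"
    using x by (auto intro: integrable_on_subinterval[OF w(1)])
  note ki = integrable_mono_on_weight[OF k w(1)]
  have "integral {0..x} (\<lambda>u. k u * w u) \<le> integral {0..x} (\<lambda>u. k x * w u)"
  proof (rule integral_le)
    show "k u * w u \<le> k x * w u" if "u \<in> {0..x}" for u
      by (rule mult_right_mono[OF mono_onD[OF k] w(2)]) (use x that in auto)
  qed (use x ki[of 0 x] wi in \<open>auto intro: integrable_on_mult_right\<close>)
  then have 1: "integral {0..x} (\<lambda>u. k u * w u) \<le> k x * integral {0..x} w" by simp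
  have "integral {x..1} (\<lambda>u. k x * w u) \<le> integral {x..1} (\<lambda>u. k u * w u)"
  proof (rule integral_le)
    show "k x * w u \<le> k u * w u" if "u \<in> {x..1}" for u
      by (rule mult_right_mono[OF mono_onD[OF k] w(2)]) (use x that in auto)
  qed (use x ki[of x 1] wi in \<open>auto intro: integrable_on_mult_right\<close>)
  then have 2: "k x * integral {x..1} w \<le> integral {x..1} (\<lambda>u. k u * w u)" by simp
  have s: "integral {0..1} (\<lambda>u. k u * w u) = integral {0..x} (\<lambda>u. k u * w u) + integral {x..1} (\<lambda>u. k u * w u)"
    "integral {0..1} w = integral {0..x} w + integral {x..1} w"
    by (rule Henstock_Kurzweil_Integration.integral_combine[symmetric]; use x ki[of 0 1] w(1) in simp)+
  have nn: "integral {0..x} w \<ge> 0" "integral {x..1} w \<ge> 0"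
    by (rule Henstock_Kurzweil_Integration.integral_nonneg[OF wi(1)]
        Henstock_Kurzweil_Integration.integral_nonneg[OF wi(2)], rule w(2), use x in simp)+
  have "integral {x..1} w * integral {0..x} (\<lambda>u. k u * w u) \<le> integral {x..1} w * (k x * integral {0..x} w)"
    using 1 nn by (intro mult_left_mono)
  also have "\<dots> = integral {0..x} w * (k x * integral {x..1} w)" by simp
  also have "\<dots> \<le> integral {0..x} w * integral {x..1} (\<lambda>u. k u * w u)"
    using 2 nn by (intro mult_left_mono)
  finally show ?thesis unfolding s by (simp add: algebra_simps)
qed

text \<open>
  The invariant distribution function before normalisation:
  \<open>G_dist N x = log_scale N x / log_scale N 1\<close>, and the derivative of \<open>log_scale\<close> is the
  weight \<open>1 / (x + N - 1)\<close>.
\<close>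

definition log_scale :: "nat \<Rightarrow> real \<Rightarrow> real" where
  "log_scale N u = ln ((u + real N - 1) / (real N - 1))"

lemma log_scale_deriv:
  assumes "N \<ge> 2" "u \<in> {0..1}"
  shows "(log_scale N has_real_derivative 1 / (u + real N - 1)) (at u within S)"
proof -
  have p: "u + real N - 1 > 0" "real N - 1 > 0" using assms by auto
  have "((\<lambda>u. ln ((u + real N - 1) / (real N - 1))) has_real_derivative 1 / (u + real N - 1)) (at u within S)"
    using p by (auto intro!: derivative_eq_intros)
  then show ?thesis unfolding log_scale_def[abs_def] .
qed

lemma log_scale_0: "N \<ge> 2 \<Longrightarrow> log_scale N 0 = 0" and log_scale_1: "log_scale N 1 = ln (real N / (real N - 1))"
  by (auto simp: log_scale_def)

lemma has_integral_log_weight: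
  assumes "N \<ge> 2" "x \<in> {0..1}"
  shows "((\<lambda>u. 1 / (u + real N - 1)) has_integral log_scale N x) {0..x}"
    "((\<lambda>u. log_scale N u * (1 / (u + real N - 1))) has_integral (log_scale N x)\<^sup>2 / 2) {0..x}"
proof -
  have "((\<lambda>u. 1 / (u + real N - 1)) has_integral log_scale N x - log_scale N 0) {0..x}"
    using assms by (intro fundamental_theorem_of_calculus)
      (auto simp flip: has_real_derivative_iff_has_vector_derivative intro!: log_scale_deriv)
  then show "((\<lambda>u. 1 / (u + real N - 1)) has_integral log_scale N x) {0..x}"
    using log_scale_0[OF assms(1)] by simp
  have D: "((\<lambda>u. (log_scale N u)\<^sup>2 / 2) has_real_derivative log_scale N u * (1 / (u + real N - 1))) (at u within S)"
    if "u \<in> {0..1}" for u S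
  proof -
    have "((\<lambda>u. (log_scale N u)\<^sup>2 / 2) has_real_derivative (of_nat 2 * (1 / (u + real N - 1) * log_scale N u ^ (2 - Suc 0))) / 2) (at u within S)"
      by (intro DERIV_cdivide DERIV_power log_scale_deriv assms(1) that)
    moreover have "(of_nat 2 * (r * l ^ (2 - Suc 0))) / 2 = l * r" for r l :: real by simp
    ultimately show ?thesis by (simp only:)
  qed
  have "((\<lambda>u. log_scale N u * (1 / (u + real N - 1))) has_integral (log_scale N x)\<^sup>2 / 2 - (log_scale N 0)\<^sup>2 / 2) {0..x}"
  proof (rule fundamental_theorem_of_calculus)
    fix u assume "u \<in> {0..x}"
    then show "((\<lambda>u. (log_scale N u)\<^sup>2 / 2) has_vector_derivative log_scale N u * (1 / (u + real N - 1))) (at u within {0..x})"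
      using D[of u "{0..x}"] assms(2) by (simp add: has_real_derivative_iff_has_vector_derivative)
  qed (use assms(2) in simp)
  then show "((\<lambda>u. log_scale N u * (1 / (u + real N - 1))) has_integral (log_scale N x)\<^sup>2 / 2) {0..x}"
    using log_scale_0[OF assms(1)] by simp
qed

lemma log_scale_1_pos:
  assumes "N \<ge> 2" shows "log_scale N 1 > 0"
  using assms unfolding log_scale_1 by simp

text \<open>
  If \<open>s * h\<close> increases at least as fast as \<open>c * log_scale N\<close>, then the difference
  satisfies Chebyshev's inequality.  Its integrals are explicit because \<open>log_scale N\<close> times its
  derivative has the primitive \<open>(log_scale N)\<^sup>2 / 2\<close>, and this produces the factor
  \<open>G (1 - G)\<close>.  The case \<open>s = 1\<close> with \<open>c \<ge> 0\<close> gives a lower bound for the distance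
  of the two distribution functions, the case \<open>s = - 1\<close> with \<open>c \<le> 0\<close> an upper bound.
\<close>

lemma distribution_gap:
  fixes h :: "real \<Rightarrow> real" and s c :: real
  assumes N: "N \<ge> 2" and h: "mono_on {0..1} h" and norm: "integral {0..1} (\<lambda>u. h u / (u + real N - 1)) = 1"
    and k: "mono_on {0..1} (\<lambda>u. s * h u - c * log_scale N u)" and x: "x \<in> {0..1}"
  shows "s * integral {0..x} (\<lambda>u. h u / (u + real N - 1)) \<le> s * G_dist N x - c / 2 * (log_scale N 1)\<^sup>2 * (G_dist N x * (1 - G_dist N x))"
proof -
  define w where "w = (\<lambda>u. 1 / (u + real N - 1))"
  define L where "L = log_scale N 1"
  define l where "l = log_scale N x"
  have L: "L > 0" using log_scale_1_pos[OF N] by (simp add: L_def)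
  have w1: "(w has_integral log_scale N z) {0..z}" and w2: "((\<lambda>u. log_scale N u * w u) has_integral (log_scale N z)\<^sup>2 / 2) {0..z}"
    if "z \<in> {0..1}" for z using has_integral_log_weight[OF N that] unfolding w_def by auto
  have wi: "w integrable_on {0..1}" using w1[of 1] by auto
  have F: "((\<lambda>u. h u * w u) has_integral integral {0..z} (\<lambda>u. h u / (u + real N - 1))) {0..z}" if "z \<in> {0..1}" for z
    using integrable_integral[OF integrable_mono_on_weight[OF h wi, of 0 z]] that by (simp add: w_def)
  have K: "integral {0..z} (\<lambda>u. (s * h u - c * log_scale N u) * w u) = s * integral {0..z} (\<lambda>u. h u / (u + real N - 1)) - c * ((log_scale N z)\<^sup>2 / 2)"
    if "z \<in> {0..1}" for z
  proof (rule integral_unique)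
    show "((\<lambda>u. (s * h u - c * log_scale N u) * w u) has_integral s * integral {0..z} (\<lambda>u. h u / (u + real N - 1)) - c * ((log_scale N z)\<^sup>2 / 2)) {0..z}"
      using has_integral_diff[OF has_integral_mult_right[OF F[OF that], of s] has_integral_mult_right[OF w2[OF that], of c]]
      by (simp add: algebra_simps)
  qed
  have I: "integral {0..1} w = L" "integral {0..x} w = l"
    using w1[of 1] w1[OF x] by (auto simp: L_def l_def integral_unique)
  have "L * (s * integral {0..x} (\<lambda>u. h u / (u + real N - 1)) - c * (l\<^sup>2 / 2)) \<le> l * (s - c * (L\<^sup>2 / 2))"
    using chebyshev_initial_segment[OF k wi _ x] K[OF x] K[of 1] N unfolding I norm
    by (simp add: w_def L_def l_def)
  moreover have "L * (s * (l / L) - c / 2 * L\<^sup>2 * (l / L * (1 - l / L))) = s * l - c / 2 * (L * L * l - L * l * l)"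
    using L by (simp add: field_simps power2_eq_square)
  ultimately have "L * (s * integral {0..x} (\<lambda>u. h u / (u + real N - 1))) \<le> L * (s * (l / L) - c / 2 * L\<^sup>2 * (l / L * (1 - l / L)))"
    by (simp add: algebra_simps power2_eq_square)
  then have "s * integral {0..x} (\<lambda>u. h u / (u + real N - 1)) \<le> s * (l / L) - c / 2 * L\<^sup>2 * (l / L * (1 - l / L))"
    using L by (simp only: mult_le_cancel_left_pos)
  moreover have "G_dist N x = l / L"
    unfolding G_dist_def L_def l_def log_scale_1 by (simp add: log_scale_def)
  ultimately show ?thesis by (simp add: L_def)
qed

text \<open>
  The density of \<open>\<mu>\<close> is \<open>f y / (y + N - 1)\<close> almost everywhere, so the transfer formula with
  an indicator function for \<open>g\<close> gives the distribution of the iterates.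
\<close>

lemma renyi_distribution:
  fixes n :: nat
  assumes N: "N \<ge> 2" and \<mu>: "prob_space \<mu>" "sets \<mu> = sets (restrict_space borel {0..1})"
    "absolutely_continuous unit_lborel \<mu>"
    and fAE: "AE y in unit_lborel. f y = (y + real N - 1) * enn2real (RN_deriv unit_lborel \<mu> y)"
    and f: "mono_on {0..1} f" "\<And>y. y \<in> {0..1} \<Longrightarrow> f y \<ge> 0"
  defines "h \<equiv> (renyi_op N ^^ n) f"
  shows "x \<in> {0..1} \<Longrightarrow> measure \<mu> {y \<in> {0..1}. (renyi_map N ^^ n) y < x} = integral {0..x} (\<lambda>u. h u / (u + real N - 1))"
    and "integral {0..1} (\<lambda>u. h u / (u + real N - 1)) = 1"
proof -
  interpret prob_space \<mu> by fact
  let ?l = "unit_lborel"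
  interpret l: finite_measure ?l
    by (rule finite_measureI) (simp add: emeasure_restrict_space)
  have sets: "sets \<mu> = sets ?l" using \<mu>(2) by (simp add: sets_restrict_space)
  have space: "space \<mu> = {0..1}" using sets_eq_imp_space_eq[OF \<mu>(2)] by (simp add: space_restrict_space)
  have dens: "density ?l (RN_deriv ?l \<mu>) = \<mu>" by (rule l.density_RN_deriv[OF \<mu>(3) sets])
  have fin: "AE y in ?l. RN_deriv ?l \<mu> y \<noteq> \<infinity>" by (rule l.RN_deriv_finite[OF _ \<mu>(3) sets]) unfold_locales
  have AE: "AE y in ?l. RN_deriv ?l \<mu> y = ennreal (f y / (y + real N - 1))"
    using fAE fin AE_space
  proof eventually_elim
    case (elim y)
    then have "y + real N - 1 > 0" using N by (auto simp: space_restrict_space)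
    then show ?case using elim by (simp add: top.not_eq_extremum)
  qed
  have [measurable]: "renyi_map N ^^ n \<in> borel_measurable borel"
  proof (induction n)
    case (Suc n)
    then show ?case by (simp add: measurable_comp[OF Suc renyi_map_measurable])
  qed (simp add: id_def)
  have main: "emeasure \<mu> {y \<in> {0..1}. (renyi_map N ^^ n) y \<in> B} =
     (\<integral>\<^sup>+ u. ennreal (h u / (u + real N - 1)) * indicator B u * indicator {0..1} u \<partial>lborel)"
    if [measurable]: "B \<in> sets borel" for B
  proof -
    let ?A = "{y \<in> {0..1}. (renyi_map N ^^ n) y \<in> B}"
    have "(renyi_map N ^^ n) -` B \<in> sets borel" by (rule measurable_sets_borel[of _ borel]) auto
    moreover have "?A = {0..1} \<inter> (renyi_map N ^^ n) -` B" by auto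
    ultimately have "?A \<in> sets ?l" by (auto simp: sets_restrict_space)
    then have "emeasure \<mu> ?A = (\<integral>\<^sup>+ y. RN_deriv ?l \<mu> y * indicator ?A y \<partial>?l)"
      by (subst dens[symmetric]) (simp add: emeasure_density)
    also have "\<dots> = (\<integral>\<^sup>+ y. ennreal (f y / (y + real N - 1)) * indicator B ((renyi_map N ^^ n) y) \<partial>?l)"
      by (rule nn_integral_cong_AE, use AE AE_space in eventually_elim)
        (auto simp: space_restrict_space split: split_indicator)
    also have "\<dots> = (\<integral>\<^sup>+ y. ennreal (f y / (y + real N - 1)) * indicator B ((renyi_map N ^^ n) y) * indicator {0..1} y \<partial>lborel)"
      by (simp add: nn_integral_restrict_space)
    also have "\<dots> = (\<integral>\<^sup>+ u. ennreal (h u / (u + real N - 1)) * indicator B u * indicator {0..1} u \<partial>lborel)"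
      unfolding h_def by (rule renyi_transfer_iter[OF N f]) measurable
    finally show ?thesis .
  qed
  have hm: "mono_on {0..1} h" unfolding h_def by (rule renyi_op_iter_mono_on[OF N f(1)])
  have h0: "h y \<ge> 0" if "y \<in> {0..1}" for y
    unfolding h_def using renyi_op_iter_nonneg[OF N f that] .
  have I: "(\<integral>\<^sup>+ u. ennreal (h u / (u + real N - 1)) * indicator {0..x} u \<partial>lborel) = ennreal (integral {0..x} (\<lambda>u. h u / (u + real N - 1)))"
    and I0: "integral {0..x} (\<lambda>u. h u / (u + real N - 1)) \<ge> 0"
    if "x \<in> {0..1}" for x
  proof -
    have w: "(\<lambda>u. 1 / (u + real N - 1)) integrable_on {0..1}" using has_integral_log_weight(1)[OF N, of 1] by auto
    have i: "(\<lambda>u. h u / (u + real N - 1)) integrable_on {0..x}"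
      using integrable_mono_on_weight[OF hm w, of 0 x] that by simp
    have nn: "h u / (u + real N - 1) \<ge> 0" if "u \<in> {0..x}" for u
      using h0[of u] that \<open>x \<in> {0..1}\<close> N by auto
    show "(\<integral>\<^sup>+ u. ennreal (h u / (u + real N - 1)) * indicator {0..x} u \<partial>lborel) = ennreal (integral {0..x} (\<lambda>u. h u / (u + real N - 1)))"
      by (rule nn_integral_has_integral_lebesgue'[OF nn integrable_integral[OF i]])
    show "integral {0..x} (\<lambda>u. h u / (u + real N - 1)) \<ge> 0"
      by (rule Henstock_Kurzweil_Integration.integral_nonneg[OF i nn])
  qed
  show "measure \<mu> {y \<in> {0..1}. (renyi_map N ^^ n) y < x} = integral {0..x} (\<lambda>u. h u / (u + real N - 1))" if "x \<in> {0..1}"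
  proof -
    have "emeasure \<mu> {y \<in> {0..1}. (renyi_map N ^^ n) y \<in> {..<x}} =
        (\<integral>\<^sup>+ u. ennreal (h u / (u + real N - 1)) * indicator {..<x} u * indicator {0..1} u \<partial>lborel)"
      by (rule main) simp
    also have "\<dots> = (\<integral>\<^sup>+ u. ennreal (h u / (u + real N - 1)) * indicator {0..x} u \<partial>lborel)"
      by (rule nn_integral_cong_AE, use AE_lborel_singleton[of x] in eventually_elim)
        (use that in \<open>auto split: split_indicator\<close>)
    finally show ?thesis unfolding I[OF that] measure_def using I0[OF that] by simp
  qed
  have one: "(1::real) \<in> {0..1}" by simp
  have "ennreal (integral {0..1} (\<lambda>u. h u / (u + real N - 1))) = ennreal 1"
    using main[of UNIV] I[OF one] emeasure_space_1 unfolding space by (simp del: atLeastAtMost_iff)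
  then show "integral {0..1} (\<lambda>u. h u / (u + real N - 1)) = 1" using I0[of 1]
    by (metis atLeastAtMost_iff ennreal_inj order_refl zero_le_one)
qed

section \<open>Two-sided error bounds\<close>

theorem theorem3p4:
  fixes N n :: nat and \<mu> :: "real measure" and f f' :: "real \<Rightarrow> real" and e t x :: real
  assumes "N \<ge> 2"
    and "prob_space \<mu>"
    and "sets \<mu> = sets (restrict_space borel {0..1})"
    and "absolutely_continuous unit_lborel \<mu>"
    and "AE y in unit_lborel. f y = (y + real N - 1) * enn2real (RN_deriv unit_lborel \<mu> y)"
    and "\<And>y. y \<in> {0..1} \<Longrightarrow> (f has_real_derivative f' y) (at y within {0..1})"
    and "continuous_on {0..1} f'"
    and "\<And>y. y \<in> {0..1} \<Longrightarrow> f' y > 0"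
    and "e > 0"
    and "H_poly N e 0 < 0"
    and "H_poly N e 1 > 0"
    and "\<And>s. s \<in> {0..1} \<Longrightarrow> deriv (H_poly N e) s > 0"
    and "t \<in> {0..1}"
    and "H_poly N e t = 0"
    and "n \<ge> 1"
    and "x \<in> {0..1}"
  shows "(ln (real N / (real N - 1)))\<^sup>2 * (real N / 2)
             * (alpha_const N e t f' / beta_const N e t f') * (INF y\<in>{0..1}. f' y)
             * v_const N e t ^ n * (G_dist N x * (1 - G_dist N x))
           \<le> \<bar>measure \<mu> {y \<in> {0..1}. (renyi_map N ^^ n) y < x} - G_dist N x\<bar>
       \<and> \<bar>measure \<mu> {y \<in> {0..1}. (renyi_map N ^^ n) y < x} - G_dist N x\<bar>
           \<le> (ln (real N / (real N - 1)))\<^sup>2 * (real N / 2)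
             * (beta_const N e t f' / alpha_const N e t f') * (SUP y\<in>{0..1}. f' y)
             * w_const N e t ^ n * (G_dist N x * (1 - G_dist N x))"
proof -
  note N = assms(1) and f'pos = assms(8) and e = assms(9) and x = assms(16)
  define b where "b = (t + 1) / e"
  have b0: "b > 0" using e assms(13) by (simp add: b_def)
  have root: "2 * (b + 1) ^ 4 = (real N)\<^sup>2 * (2 * real N - 1) * b + real N ^ 3"
    by (rule root_equation[OF e assms(14) b_def])
  have b: "b > 0" "real N - 2 < b" "b < real N - 1" using b0 root_bounds[OF N b0 root] by auto
  define \<psi> where "\<psi> = (\<lambda>u. test_fun N b u / e)"
  define P where "P = (\<lambda>u. test_prim N b u / e)"
  have phi: "phi N e t = (\<lambda>u. - (1 / e) * test_fun N b u)" "- phi N e t u = \<psi> u" for u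
    using phi_eq_test_fun[OF e, of N t] by (auto simp: b_def \<psi>_def fun_eq_iff)
  have \<psi>pos: "\<psi> u > 0" if "u \<in> {0..1}" for u
    unfolding \<psi>_def using test_fun_pos[OF N b that] e by simp
  have \<psi>cont: "continuous_on {0..1} \<psi>"
    unfolding \<psi>_def using test_fun_cont[OF N b] e by (intro continuous_intros) auto
  have P': "(P has_real_derivative \<psi> u) (at u within {0..1})" if "u \<in> {0..1}" for u
    unfolding P_def \<psi>_def by (intro DERIV_cdivide test_prim_deriv[OF N b that])
  have Pmono: "mono_on {0..1} P"
    using P' \<psi>pos by (intro mono_on_unit_if_deriv_nonneg[of P \<psi>]) (auto intro: less_imp_le)

  \<comment> \<open>\<open>W\<close> is the image of \<open>phi\<close> under \<open>V_op\<close>, and at the same time the derivative of \<open>renyi_op N P\<close>\<close>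
  define W where "W = (\<lambda>u. 1 / (e * (u + b)\<^sup>2))"
  have Wpos: "W u > 0" if "u \<in> {0..1}" for u using that b e by (simp add: W_def)
  have V: "V_op N (phi N e t) u = W u" if "u \<in> {0..1}" for u
    unfolding phi(1) W_def using V_op_test_fun[OF N b that, of "1 / e"] by (simp add: algebra_simps)
  have UP: "renyi_op N P u = - 1 / (e * (u + b))" if "u \<in> {0..1}" for u
  proof -
    have "renyi_op N (\<lambda>y. (1 / e) * test_prim N b y - 0 * test_prim N b y) u = - 1 / (e * (u + b))"
      using renyi_op_diff[OF N that test_prim_mono_on[OF N b] test_prim_mono_on[OF N b], of "1 / e" 0]
        renyi_op_test_prim[OF N b(1) that] by simp
    then show ?thesis by (simp add: P_def)
  qed
  have UP': "(renyi_op N P has_real_derivative W u) (at u within {0..1})" if "u \<in> {0..1}" for u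
  proof (rule has_field_derivative_transform_within[OF _ zero_less_one that])
    show "((\<lambda>u. - 1 / (e * (u + b))) has_real_derivative W u) (at u within {0..1})"
      using e add_nonneg_pos[of u b] that b by (auto intro!: derivative_eq_intros simp: W_def power2_eq_square)
  qed (simp add: UP)

  define v where "v = v_const N e t"
  have v: "v = real N / (2 * (b + 1)\<^sup>2)"
  proof -
    have "e + t + 1 = e * (b + 1)" using e by (simp add: b_def field_simps)
    then show ?thesis using e by (simp add: v_def v_const_def power_mult_distrib)
  qed
  have v0: "v > 0" using v N b by simp
  have vW: "v * \<psi> u \<le> W u" if "u \<in> {0..1}" for u
  proof -
    have ub: "u + b > 0" using that b by simp
    have "v * (test_fun N b u * (u + b)\<^sup>2) \<le> v * (2 * (b + 1)\<^sup>2 / real N)"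
      using test_ratio_le[OF N b that root] v0 by (intro mult_left_mono) auto
    also have "\<dots> = 1" using v N b by simp
    finally show ?thesis using e ub by (simp add: \<psi>_def W_def field_simps)
  qed
  define w where "w = w_const N e t"
  have w: "w > 0 \<and> (\<forall>u\<in>{0..1}. W u \<le> w * \<psi> u)"
  proof -
    define q where "q = (\<lambda>u. \<psi> u / W u)"
    have qpos: "q u > 0" if "u \<in> {0..1}" for u using \<psi>pos[OF that] Wpos[OF that] by (simp add: q_def)
    have "continuous_on {0..1} W" unfolding W_def using b e by (intro continuous_intros) force
    then have qc: "continuous_on {0..1} q" unfolding q_def by (intro continuous_intros \<psi>cont) (auto dest: Wpos)
    define i where "i = (INF u\<in>{0..1}. q u)"
    have i: "i > 0" "\<And>u. u \<in> {0..1} \<Longrightarrow> i \<le> q u"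
      unfolding i_def using continuous_on_unit_bounds[OF qc] qpos by auto
    have "m_const N e t = (SUP u\<in>{0..1}. - q u)"
      unfolding m_const_def by (intro SUP_cong) (auto simp: q_def V simp flip: phi(2))
    also have "\<dots> = - i" unfolding i_def Inf_real_def by (simp add: image_image)
    finally have "w = 1 / i" by (simp add: w_def w_const_def)
    moreover have "W u \<le> \<psi> u / i" if "u \<in> {0..1}" for u
      using i(1) i(2)[OF that] Wpos[OF that] by (simp add: q_def field_simps)
    ultimately show ?thesis using i by simp
  qed

  define \<alpha> where "\<alpha> = alpha_const N e t f'"
  define \<beta> where "\<beta> = beta_const N e t f'"
  have rc: "continuous_on {0..1} (\<lambda>u. \<psi> u / f' u)"
    by (intro continuous_intros \<psi>cont assms(7)) (auto dest: f'pos)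
  have rpos: "\<psi> u / f' u > 0" if "u \<in> {0..1}" for u using \<psi>pos[OF that] f'pos[OF that] by simp
  have \<alpha>0: "\<alpha> > 0" unfolding \<alpha>_def alpha_const_def phi(2) by (rule continuous_on_unit_bounds(3)[OF rc rpos])
  have \<alpha>: "\<alpha> * f' u \<le> \<psi> u" and \<beta>: "\<psi> u \<le> \<beta> * f' u" if "u \<in> {0..1}" for u
  proof -
    show "\<alpha> * f' u \<le> \<psi> u"
      using continuous_on_unit_bounds(1)[OF rc that] f'pos[OF that]
      unfolding \<alpha>_def alpha_const_def phi(2) by (simp add: pos_le_divide_eq)
    show "\<psi> u \<le> \<beta> * f' u"
      using continuous_on_unit_bounds(2)[OF rc that] f'pos[OF that]
      unfolding \<beta>_def beta_const_def phi(2) by (simp add: pos_divide_le_eq)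
  qed
  have \<beta>0: "\<beta> > 0"
    using \<beta>[of 0] \<psi>pos[of 0] f'pos[of 0] by (smt (verit) atLeastAtMost_iff zero_less_mult_pos2)
  define m M where "m = (INF y\<in>{0..1}. f' y)" and "M = (SUP y\<in>{0..1}. f' y)"
  have m: "m \<le> f' u" "f' u \<le> M" if "u \<in> {0..1}" for u
    unfolding m_def M_def using continuous_on_unit_bounds[OF assms(7)] that by auto
  have m0: "m > 0" unfolding m_def by (rule continuous_on_unit_bounds(3)[OF assms(7) f'pos])

  have fmono: "mono_on {0..1} f"
    using assms(6) f'pos by (intro mono_on_unit_if_deriv_nonneg[of f f']) (auto intro: less_imp_le)
  have fcont: "continuous_on {0..1} f"
    using assms(6) by (meson DERIV_continuous continuous_on_eq_continuous_within)
  have "AE y in unit_lborel. f y \<ge> 0"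
    using assms(5) AE_space
  proof eventually_elim
    case (elim y)
    then have "y + real N - 1 \<ge> 0" using N by (auto simp: space_restrict_space)
    then show ?case using elim by simp
  qed
  then have fnn: "f y \<ge> 0" if "y \<in> {0..1}" for y using nonneg_of_AE_nonneg[OF fmono fcont _ that] by blast

  define h where "h = (renyi_op N ^^ n) f"
  have hmono: "mono_on {0..1} h" unfolding h_def by (rule renyi_op_iter_mono_on[OF N fmono])
  have lower: "mono_on {0..1} (\<lambda>u. h u - 1 / \<beta> * v ^ n * P u)"
    unfolding h_def
  proof (rule renyi_op_iter_lower[OF N Pmono _ _ fmono])
    show "mono_on {0..1} (\<lambda>u. renyi_op N P u - v * P u)"
      using vW by (intro mono_on_unit_if_deriv_nonneg[where g' = "\<lambda>u. W u - v * \<psi> u"]) (auto intro!: derivative_intros UP' DERIV_cmult P')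
    show "mono_on {0..1} (\<lambda>u. f u - 1 / \<beta> * P u)"
      using \<beta> \<beta>0 by (intro mono_on_unit_if_deriv_nonneg[where g' = "\<lambda>u. f' u - 1 / \<beta> * \<psi> u"] DERIV_diff DERIV_cmult P' assms(6))
        (auto simp: field_simps)
  qed (use v0 \<beta>0 in auto)
  have upper: "mono_on {0..1} (\<lambda>u. 1 / \<alpha> * w ^ n * P u - h u)"
    unfolding h_def
  proof (rule renyi_op_iter_upper[OF N Pmono _ _ fmono])
    show "mono_on {0..1} (\<lambda>u. w * P u - renyi_op N P u)"
      using w by (intro mono_on_unit_if_deriv_nonneg[where g' = "\<lambda>u. w * \<psi> u - W u"]) (auto intro!: derivative_intros UP' DERIV_cmult P')
    show "mono_on {0..1} (\<lambda>u. 1 / \<alpha> * P u - f u)"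
      using \<alpha> \<alpha>0 by (intro mono_on_unit_if_deriv_nonneg[where g' = "\<lambda>u. 1 / \<alpha> * \<psi> u - f' u"] DERIV_diff DERIV_cmult P' assms(6))
        (auto simp: field_simps)
  qed (use w \<alpha>0 in auto)

  \<comment> \<open>Trading \<open>P\<close> for the logarithm, the factor \<open>N\<close> is the weight at the point \<open>1\<close>.\<close>
  define cl where "cl = \<alpha> / \<beta> * m * v ^ n * real N"
  define cu where "cu = \<beta> / \<alpha> * M * w ^ n * real N"
  have cl0: "cl \<ge> 0" using \<alpha>0 \<beta>0 m0 v0 by (simp add: cl_def)
  have clog: "mono_on {0..1} (\<lambda>u. 1 * h u - cl * log_scale N u)"
  proof (rule mono_on_unit_add[OF lower])
    show "mono_on {0..1} (\<lambda>u. 1 / \<beta> * v ^ n * P u - cl * log_scale N u)"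
    proof (rule mono_on_unit_if_deriv_nonneg)
      show "((\<lambda>u. 1 / \<beta> * v ^ n * P u - cl * log_scale N u) has_real_derivative
          (1 / \<beta> * v ^ n * \<psi> u - cl * (1 / (u + real N - 1)))) (at u within {0..1})" if "u \<in> {0..1}" for u
        by (intro DERIV_diff DERIV_cmult P' log_scale_deriv N that)
      show "0 \<le> 1 / \<beta> * v ^ n * \<psi> u - cl * (1 / (u + real N - 1))" if u: "u \<in> {0..1}" for u
      proof -
        have p: "u + real N - 1 > 0" using u N by auto
        have "\<alpha> * m \<le> \<psi> 1" using \<alpha>[of 1] m(1)[of 1] \<alpha>0 by (smt (verit) atLeastAtMost_iff mult_left_mono)
        then have "\<alpha> * m * real N \<le> 2 / e" using test_fun_1[OF N, of b] N e by (simp add: \<psi>_def field_simps)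
        also have "\<dots> \<le> \<psi> u * (u + real N - 1)"
          using test_fun_lower[OF N b u] e by (simp add: \<psi>_def divide_right_mono)
        finally have "\<alpha> * m * real N / (u + real N - 1) \<le> \<psi> u" using p by (simp add: pos_divide_le_eq)
        then have "v ^ n / \<beta> * (\<alpha> * m * real N / (u + real N - 1)) \<le> v ^ n / \<beta> * \<psi> u"
          using v0 \<beta>0 by (intro mult_left_mono) auto
        then show ?thesis by (simp add: cl_def mult_ac)
      qed
    qed
  qed simp
  have culog: "mono_on {0..1} (\<lambda>u. (- 1) * h u - (- cu) * log_scale N u)"
  proof (rule mono_on_unit_add[OF upper])
    show "mono_on {0..1} (\<lambda>u. cu * log_scale N u - 1 / \<alpha> * w ^ n * P u)"
    proof (rule mono_on_unit_if_deriv_nonneg)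
      show "((\<lambda>u. cu * log_scale N u - 1 / \<alpha> * w ^ n * P u) has_real_derivative
          (cu * (1 / (u + real N - 1)) - 1 / \<alpha> * w ^ n * \<psi> u)) (at u within {0..1})" if "u \<in> {0..1}" for u
        by (intro DERIV_diff DERIV_cmult P' log_scale_deriv N that)
      show "0 \<le> cu * (1 / (u + real N - 1)) - 1 / \<alpha> * w ^ n * \<psi> u" if u: "u \<in> {0..1}" for u
      proof -
        have p: "u + real N - 1 > 0" "u + real N - 1 \<le> real N" using u N by auto
        have "\<psi> u * (u + real N - 1) \<le> \<beta> * M * real N"
          using \<beta>[OF u] m(2)[OF u] \<beta>0 p f'pos[OF u] \<psi>pos[OF u]
          by (intro mult_mono order_trans[OF \<beta>[OF u]] mult_left_mono) auto
        then have "\<psi> u \<le> \<beta> * M * real N / (u + real N - 1)" using p by (simp add: pos_le_divide_eq)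
        then have "w ^ n / \<alpha> * \<psi> u \<le> w ^ n / \<alpha> * (\<beta> * M * real N / (u + real N - 1))"
          using w \<alpha>0 by (intro mult_left_mono) auto
        then show ?thesis by (simp add: cu_def mult_ac)
      qed
    qed
  qed simp

  define F where "F = measure \<mu> {y \<in> {0..1}. (renyi_map N ^^ n) y < x}"
  define G where "G = G_dist N x"
  define L where "L = ln (real N / (real N - 1))"
  note dist = renyi_distribution[OF N assms(2-5) fmono fnn]
  have F: "F = integral {0..x} (\<lambda>u. h u / (u + real N - 1))"
    unfolding F_def h_def by (rule dist(1)[OF _ x])
  have one: "integral {0..1} (\<lambda>u. h u / (u + real N - 1)) = 1"
    unfolding h_def by (rule dist(2))
  have 1: "F \<le> G - cl / 2 * L\<^sup>2 * (G * (1 - G))"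
    using distribution_gap[OF N hmono one clog x] by (simp add: F G_def L_def log_scale_1)
  have 2: "G - F \<le> cu / 2 * L\<^sup>2 * (G * (1 - G))"
    using distribution_gap[OF N hmono one culog x] by (simp add: F G_def L_def log_scale_1)
  have G: "0 \<le> G" "G \<le> 1"
  proof -
    have "1 \<le> (x + real N - 1) / (real N - 1)" "(x + real N - 1) / (real N - 1) \<le> real N / (real N - 1)"
      using x N by (auto intro!: divide_right_mono)
    then have "0 \<le> log_scale N x" "log_scale N x \<le> log_scale N 1" by (auto simp: log_scale_def)
    moreover have "G = log_scale N x / log_scale N 1"
      by (simp add: G_def G_dist_def log_scale_1 log_scale_def)
    ultimately show "0 \<le> G" "G \<le> 1" using log_scale_1_pos[OF N] by auto
  qed
  have "0 \<le> cl / 2 * L\<^sup>2 * (G * (1 - G))" using cl0 G by auto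
  with 1 have abs: "\<bar>F - G\<bar> = G - F" by simp
  have "L\<^sup>2 * (real N / 2) * (\<alpha> / \<beta>) * m * v ^ n * (G * (1 - G)) \<le> \<bar>F - G\<bar>"
    using 1 unfolding abs cl_def by (simp add: mult_ac)
  moreover have "\<bar>F - G\<bar> \<le> L\<^sup>2 * (real N / 2) * (\<beta> / \<alpha>) * M * w ^ n * (G * (1 - G))"
    using 2 unfolding abs cu_def by (simp add: mult_ac)
  ultimately show ?thesis
    unfolding F_def G_def L_def \<alpha>_def \<beta>_def m_def M_def v_def w_def by blast
qed

end
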